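(* Let $n\ge 1$ be an integer and $1\le p\le\infty$ (with the convention $1/\infty=0$). Then: (i) the tensor radius of $\ell_p^n$ is $\rho_\infty(\ell_p^n)=n^{1-\left|\frac12-\frac1p\right|}$; (ii) the tensor radius of $S_p^n$ is $\rho_\infty(S_p^n)=n^{2-\left|\frac12-\frac1p\right|}$.
   Context: The scalar field is $\mathbb{K}\in\{\mathbb{R},\mathbb{C}\}$. $\ell_p^n$ is $\mathbb{K}^n$ with the usual $p$-norm. $S_p^n$ is the space of $n\times n$ matrices over $\mathbb{K}$ equipped with the Schatten $p$-norm $\|A\|_{S_p}=(\mathrm{Tr}\,|A|^p)^{1/p}$, where $|A|=(A^*A)^{1/2}$ (for $p=\infty$, the operator norm). For a finite-dimensional normed space $X$ with dual $X^*$ and dual unit ball $B_{X^*}$, and an integer $k\ge 1$, the algebraic tensor power $X^{\otimes k}$ carries the injective norm $\|z\|_{\varepsilon_k(X)}=\sup\{|(\lambda_1\otimes\cdots\otimes\lambda_k)(z)| : \lambda_1,\dots,\lambda_k\in B_{X^*}\}$ and the projective norm $\|z\|_{\pi_k(X)}=\inf\{\sum_{i=1}^m \|x_i^{(1)}\|_X\cdots\|x_i^{(k)}\|_X : m\in\mathbb{N},\ z=\sum_{i=1}^m x_i^{(1)}\otimes\cdots\otimes x_i^{(k)}\}$. Define $\rho_k(X)=\left(\sup_{z\in X^{\otimes k},\, z\ne 0}\frac{\|z\|_{\pi_k(X)}}{\|z\|_{\varepsilon_k(X)}}\right)^{1/k}$ and the tensor radius $\rho_\infty(X)=\lim_{k\to\infty}\rho_k(X)$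 (this limit exists). *)

theory Defs
  imports "HOL-Analysis.Analysis" "Jordan_Normal_Form.Conjugate"
begin

text \<open>
  A normed space over the field \<open>'k\<close> is given by its vector type \<open>'v\<close>, its scalar
  multiplication \<open>s\<close> and its norm \<open>N\<close>. The norm is a parameter, not a type class instance,
  because one vector type carries a different norm for every exponent \<open>p\<close>.
\<close>

definition dual_ball ::
    "('k::real_normed_field \<Rightarrow> 'v::ab_group_add \<Rightarrow> 'v) \<Rightarrow> ('v \<Rightarrow> real) \<Rightarrow> ('v \<Rightarrow> 'k) set" where
  "dual_ball s N = {\<phi>. Vector_Spaces.linear s times \<phi> \<and> (\<forall>x. N x \<le> 1 \<longrightarrow> norm (\<phi> x) \<le> 1)}"

text \<open>
  For finite-dimensional \<open>X\<close>, the algebraic tensor power is realised in the space of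
  \<open>k\<close>-linear forms on the dual space: \<open>x\<^sub>1 \<otimes> \<dots> \<otimes> x\<^sub>k\<close> is the form
  \<open>(\<phi>\<^sub>1, \<dots>, \<phi>\<^sub>k) \<mapsto> \<phi>\<^sub>1(x\<^sub>1) \<cdots> \<phi>\<^sub>k(x\<^sub>k)\<close>. This canonical map from the tensor power is an
  isomorphism, and \<open>(\<phi>\<^sub>1 \<otimes> \<dots> \<otimes> \<phi>\<^sub>k)(z)\<close> is simply the value of \<open>z\<close> at
  \<open>(\<phi>\<^sub>1, \<dots>, \<phi>\<^sub>k)\<close>. Tuples are lists; a form is set to \<open>0\<close> on lists that are not
  \<open>k\<close>-tuples of linear functionals, so that tensors are equal iff the forms are.
\<close>

definition elem_tensor ::
    "('k::real_normed_field \<Rightarrow> 'v::ab_group_add \<Rightarrow> 'v) \<Rightarrow> 'v list \<Rightarrow> ('v \<Rightarrow> 'k) list \<Rightarrow> 'k" where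
  "elem_tensor s xs = (\<lambda>\<phi>s.
     if length \<phi>s = length xs \<and> (\<forall>\<phi>\<in>set \<phi>s. Vector_Spaces.linear s times \<phi>)
     then \<Prod>i<length xs. (\<phi>s ! i) (xs ! i) else 0)"

definition tensor_power ::
    "('k::real_normed_field \<Rightarrow> 'v::ab_group_add \<Rightarrow> 'v) \<Rightarrow> nat \<Rightarrow> (('v \<Rightarrow> 'k) list \<Rightarrow> 'k) set" where
  "tensor_power s k = {z. \<exists>(m::nat) xs c. (\<forall>i<m. length (xs i) = k) \<and>
     z = (\<lambda>\<phi>s. \<Sum>i<m. c i * elem_tensor s (xs i) \<phi>s)}"

definition injective_norm ::
    "('k::real_normed_field \<Rightarrow> 'v::ab_group_add \<Rightarrow> 'v) \<Rightarrow> ('v \<Rightarrow> real) \<Rightarrow> nat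
      \<Rightarrow> (('v \<Rightarrow> 'k) list \<Rightarrow> 'k) \<Rightarrow> real" where
  "injective_norm s N k z = Sup {norm (z \<phi>s) | \<phi>s. length \<phi>s = k \<and> set \<phi>s \<subseteq> dual_ball s N}"

definition projective_norm ::
    "('k::real_normed_field \<Rightarrow> 'v::ab_group_add \<Rightarrow> 'v) \<Rightarrow> ('v \<Rightarrow> real) \<Rightarrow> nat
      \<Rightarrow> (('v \<Rightarrow> 'k) list \<Rightarrow> 'k) \<Rightarrow> real" where
  "projective_norm s N k z = Inf {\<Sum>i<m. \<Prod>j<k. N (xs i ! j) | (m::nat) xs.
     (\<forall>i<m. length (xs i) = k) \<and> z = (\<lambda>\<phi>s. \<Sum>i<m. elem_tensor s (xs i) \<phi>s)}"

definition tensor_rho ::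
    "('k::real_normed_field \<Rightarrow> 'v::ab_group_add \<Rightarrow> 'v) \<Rightarrow> ('v \<Rightarrow> real) \<Rightarrow> nat \<Rightarrow> real" where
  "tensor_rho s N k = root k (Sup {projective_norm s N k z / injective_norm s N k z | z.
     z \<in> tensor_power s k \<and> z \<noteq> (\<lambda>\<phi>s. 0)})"

text \<open>As with \<open>sums\<close>, existence of the limit is part of the assertion.\<close>

definition has_tensor_radius ::
    "('k::real_normed_field \<Rightarrow> 'v::ab_group_add \<Rightarrow> 'v) \<Rightarrow> ('v \<Rightarrow> real) \<Rightarrow> real \<Rightarrow> bool" where
  "has_tensor_radius s N r \<longleftrightarrow> tensor_rho s N \<longlonglongrightarrow> r"

definition lp_norm :: "ereal \<Rightarrow> 'k::real_normed_field ^ 'n \<Rightarrow> real" where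
  "lp_norm p x = (if p = \<infinity> then Max (range (\<lambda>i. norm (x $ i)))
     else (\<Sum>i\<in>UNIV. norm (x $ i) powr real_of_ereal p) powr (1 / real_of_ereal p))"

definition adjoint_mat :: "'k::conjugate ^ 'n ^ 'm \<Rightarrow> 'k ^ 'm ^ 'n" where
  "adjoint_mat A = transpose (map_matrix conjugate A)"

definition unitary_mat :: "'k::{real_normed_field, conjugatable_field} ^ 'n ^ 'n \<Rightarrow> bool" where
  "unitary_mat U \<longleftrightarrow> adjoint_mat U ** U = mat 1 \<and> U ** adjoint_mat U = mat 1"

definition diag_mat :: "('n \<Rightarrow> real) \<Rightarrow> 'k::real_normed_field ^ 'n ^ 'n" where
  "diag_mat d = (\<chi> i j. if i = j then of_real (d i) else 0)"

text \<open>
  Real powers of a positive semidefinite matrix by functional calculus; the result does not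
  depend on the chosen diagonalisation.
\<close>

definition psd_powr ::
    "'k::{real_normed_field, conjugatable_field} ^ 'n ^ 'n \<Rightarrow> real \<Rightarrow> 'k ^ 'n ^ 'n" where
  "psd_powr M a = (THE B. \<exists>U d. unitary_mat U \<and> (\<forall>i. 0 \<le> d i) \<and>
     M = U ** diag_mat d ** adjoint_mat U \<and>
     B = U ** diag_mat (\<lambda>i. d i powr a) ** adjoint_mat U)"

definition abs_mat :: "'k::{real_normed_field, conjugatable_field} ^ 'n ^ 'n \<Rightarrow> 'k ^ 'n ^ 'n" where
  "abs_mat A = psd_powr (adjoint_mat A ** A) (1 / 2)"

text \<open>
  The trace of \<open>|A|\<^sup>p\<close> is a nonnegative real element of \<open>'k\<close>; \<open>norm\<close> only turns it into a
  value of type \<^typ>\<open>real\<close>. The operator norm is taken with respect to the Euclidean norm,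
  which is the library norm on \<open>'k ^ 'n\<close>.
\<close>

definition schatten_norm ::
    "ereal \<Rightarrow> 'k::{real_normed_field, conjugatable_field} ^ 'n ^ 'n \<Rightarrow> real" where
  "schatten_norm p A = (if p = \<infinity> then onorm (\<lambda>x. A *v x)
     else norm (trace (psd_powr (abs_mat A) (real_of_ereal p))) powr (1 / real_of_ereal p))"

definition vec_scale :: "'k::real_normed_field \<Rightarrow> 'k ^ 'n \<Rightarrow> 'k ^ 'n" where
  "vec_scale c x = c *s x"

definition mat_scale :: "'k::real_normed_field \<Rightarrow> 'k ^ 'n ^ 'm \<Rightarrow> 'k ^ 'n ^ 'm" where
  "mat_scale c A = map_matrix (\<lambda>a. c * a) A"

end

theory Submission
  imports Defs
begin

text \<open>
  Let \<open>d\<close> be the dimension of \<open>X\<close>, equipped with a Euclidean norm, and let \<open>c'\<close> and \<open>c\<close> be the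
  largest Euclidean norms on the unit balls of \<open>X\<close> and of its dual. If both balls contain tight
  frames of vectors of these extremal norms, then the tensor radius is \<open>d / (c c')\<close>.

  Upper bound: the \<open>k\<close>-fold tensor products of the frame in the dual ball are again a tight frame, so
  averaging \<open>\<bar>z(\<phi>\<^sub>1, \<dots>, \<phi>\<^sub>k)\<bar>\<^sup>2\<close> over it bounds the Euclidean norm of \<open>z\<close> by \<open>(d\<^bsup>1/2\<^esup> / c)\<^sup>k\<close>
  times the injective norm. Expanding \<open>z\<close> in the frame in the unit ball of \<open>X\<close> bounds the projective
  norm by \<open>(d\<^bsup>1/2\<^esup> / c')\<^sup>k\<close> times the Euclidean norm. For \<open>\<ell>\<^sub>p\<close> the frames are the unit vectors and
  the rescaled sign vectors; for Schatten classes they are the matrix units and the rescaled signed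
  permutation matrices.

  Lower bound: comparing with the Euclidean space loses \<open>(c c')\<^sup>k\<close>. A random sign tensor has
  Euclidean injective norm \<open>e\<^bsup>o(k)\<^esup>\<close>, by an exponential moment estimate on a fixed finite net in each
  factor, and pairing it with itself bounds its projective norm from below by \<open>d\<^sup>k e\<^bsup>-o(k)\<^esup>\<close>.
\<close>

section \<open>Scalars and tight frames\<close>

text \<open>The two bounds meet because the frame vectors have the extremal norms. In the upper
  bound these norms enter through the frame constants: the trace of the frame operator gives |B| c^2
  = \<kappa> d and |A| c'^2 = \<kappa>' d, so the losses sqrt(d)/c and sqrt(d)/c' multiply to d/(c
  c'). In the lower bound the same c and c' enter as operator norms between X and Euclidean space.
  Shorter frame vectors would leave a gap. In both families c c' = n^|1/2 - 1/p|. For p <= 2, c' = 1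
  is reached by unit vectors or matrix units, and c = n^(1/p - 1/2) is reached in the dual ball by
  sign vectors or signed permutations; for p > 2 the two frames change places. All frame vectors
  have real coordinates, so one construction serves both scalar fields. The upper bound holds
  without error for every k >= 1; only the lower bound needs the limit. The net costs (1 -
  \<delta>)^(-k), which no k-th root removes. Hence \<delta> is fixed first, small enough for the
  gap at hand, and k tends to infinity afterwards.\<close>

text \<open>Real and complex scalars are treated together: all that is needed about them can be read off
  an isometric embedding into the complex numbers.\<close>

class scalar_field = real_normed_field + conjugatable_field + heine_borel +
  assumes complex_embedding: "\<exists>h :: 'a \<Rightarrow> complex. (\<forall>x. norm (h x) = norm x) \<and>
    (\<forall>x y. h (x + y) = h x + h y) \<and> (\<forall>x y. h (x * y) = h x * h y) \<and>
    (\<forall>r. h (r *\<^sub>R 1) = of_real r) \<and> (\<forall>x. h (conjugate x) = cnj (h x))"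

instance real :: scalar_field
  by standard (rule exI[of _ complex_of_real], simp)

instance complex :: scalar_field
  by standard (rule exI[of _ "\<lambda>x. x"], simp add: scaleR_conv_of_real)

text \<open>Over the complex numbers, conjugation satisfies the same conditions, so the chosen map
  need not be the identity; everything below rests on the listed properties alone.\<close>

definition emb :: "'k::scalar_field \<Rightarrow> complex" where
  "emb = (SOME h. (\<forall>x. norm (h x) = norm x) \<and>
    (\<forall>x y. h (x + y) = h x + h y) \<and> (\<forall>x y. h (x * y) = h x * h y) \<and>
    (\<forall>r. h (r *\<^sub>R 1) = of_real r) \<and> (\<forall>x. h (conjugate x) = cnj (h x)))"

lemma
  fixes x y :: "'k::scalar_field"
  shows norm_emb [simp]: "norm (emb x) = norm x"
    and emb_add: "emb (x + y) = emb x + emb y"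
    and emb_mult: "emb (x * y) = emb x * emb y"
    and emb_of_real [simp]: "emb (of_real r :: 'k) = of_real r"
    and emb_conjugate: "emb (conjugate x) = cnj (emb x)"
  using someI_ex[OF complex_embedding[where 'a = 'k], folded emb_def] by (auto simp: of_real_def)

lemma emb_0 [simp]: "emb 0 = 0"
  using emb_of_real[of 0] by simp

lemma emb_diff: "emb (x - y) = emb x - emb y"
  using emb_add[of "x - y" y] by simp

lemma emb_sum: "emb (sum f A) = (\<Sum>a\<in>A. emb (f a))"
  by (induction A rule: infinite_finite_induct) (simp_all add: emb_add)

lemma emb_inject [simp]: "emb x = emb y \<longleftrightarrow> x = y"
  using norm_emb[of "x - y"] by (auto simp: emb_diff simp del: norm_emb)

lemma mult_conjugate_eq_norm: "x * conjugate x = of_real ((norm x)\<^sup>2)"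
  for x :: "'k::scalar_field"
proof -
  have "emb (x * conjugate x) = emb (of_real ((norm x)\<^sup>2) :: 'k)"
    by (simp add: emb_mult emb_conjugate flip: complex_norm_square del: of_real_power)
  then show ?thesis
    by (simp only: emb_inject)
qed

lemma norm_conjugate [simp]: "norm (conjugate x) = norm x" for x :: "'k::scalar_field"
  by (metis norm_emb emb_conjugate complex_mod_cnj)

lemma conjugate_of_real [simp]: "conjugate (of_real r) = (of_real r :: 'k::scalar_field)"
  by (metis emb_conjugate emb_inject emb_of_real complex_cnj_complex_of_real)

lemma norm_sq_emb: "(norm x)\<^sup>2 = (Re (emb x))\<^sup>2 + (Im (emb x))\<^sup>2" for x :: "'k::scalar_field"
  by (metis cmod_power2 norm_emb)

text \<open>Parseval identity for a tight frame: the hypothesis makes distinct columns of the matrix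
  \<open>W\<close> orthogonal, all with squared norm \<kappa>, so the cross terms of the expanded
  square vanish.\<close>

lemma frame_norm_real:
  fixes W :: "'b \<Rightarrow> 'c \<Rightarrow> real" and x :: "'c \<Rightarrow> real"
  assumes "finite \<Omega>"
    and "\<And>I J. I \<in> \<Omega> \<Longrightarrow> J \<in> \<Omega> \<Longrightarrow> (\<Sum>b\<in>B. W b I * W b J) = (if I = J then \<kappa> else 0)"
  shows "(\<Sum>b\<in>B. (\<Sum>I\<in>\<Omega>. W b I * x I)\<^sup>2) = \<kappa> * (\<Sum>I\<in>\<Omega>. (x I)\<^sup>2)"
proof -
  have "(\<Sum>b\<in>B. (\<Sum>I\<in>\<Omega>. W b I * x I)\<^sup>2) = (\<Sum>b\<in>B. \<Sum>I\<in>\<Omega>. \<Sum>J\<in>\<Omega>. x I * x J * (W b I * W b J))"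
    by (simp add: power2_eq_square sum_product mult_ac)
  also have "\<dots> = (\<Sum>I\<in>\<Omega>. \<Sum>J\<in>\<Omega>. x I * x J * (\<Sum>b\<in>B. W b I * W b J))"
    by (simp add: sum.swap[of _ _ B] sum_distrib_left)
  also have "\<dots> = (\<Sum>I\<in>\<Omega>. \<Sum>J\<in>\<Omega>. if I = J then \<kappa> * (x I)\<^sup>2 else 0)"
    by (intro sum.cong refl) (auto simp: assms(2) power2_eq_square)
  finally show ?thesis
    using assms(1) by (simp add: sum_distrib_left)
qed

lemma norm_sum_of_real_mult:
  fixes z :: "'c \<Rightarrow> 'k::scalar_field"
  shows "(norm (\<Sum>I\<in>\<Omega>. of_real (w I) * z I))\<^sup>2 =
    (\<Sum>I\<in>\<Omega>. w I * Re (emb (z I)))\<^sup>2 + (\<Sum>I\<in>\<Omega>. w I * Im (emb (z I)))\<^sup>2"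
proof -
  have "norm (\<Sum>I\<in>\<Omega>. of_real (w I) * z I) = norm (\<Sum>I\<in>\<Omega>. of_real (w I) * emb (z I))"
    by (subst norm_emb[symmetric]) (simp add: emb_sum emb_mult del: norm_emb)
  then show ?thesis
    by (simp add: cmod_power2)
qed

text \<open>As \<open>W\<close> is real, it acts separately on the real and imaginary parts of the
  embedded scalars, and the real identity applies to each.\<close>

lemma frame_norm:
  fixes W :: "'b \<Rightarrow> 'c \<Rightarrow> real" and z :: "'c \<Rightarrow> 'k::scalar_field"
  assumes "finite \<Omega>"
    and "\<And>I J. I \<in> \<Omega> \<Longrightarrow> J \<in> \<Omega> \<Longrightarrow> (\<Sum>b\<in>B. W b I * W b J) = (if I = J then \<kappa> else 0)"
  shows "(\<Sum>b\<in>B. (norm (\<Sum>I\<in>\<Omega>. of_real (W b I) * z I))\<^sup>2) = \<kappa> * (\<Sum>I\<in>\<Omega>. (norm (z I))\<^sup>2)"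
  by (simp add: norm_sum_of_real_mult norm_sq_emb[of "z _"] sum.distrib distrib_left
        frame_norm_real[OF assms])

abbreviation tuples :: "nat \<Rightarrow> 'a set \<Rightarrow> (nat \<Rightarrow> 'a) set" where
  "tuples k A \<equiv> Pi\<^sub>E {..<k} (\<lambda>_. A)"

text \<open>Gram matrices multiply under tensor products: the sum over \<open>tuples k B\<close>
  factors into one sum per position. Tuples are extensional, so two different ones differ at some
  \<open>j < k\<close>, and the factor there is 0.\<close>

lemma frame_tuples:
  fixes W :: "'b \<Rightarrow> 'c \<Rightarrow> real"
  assumes "finite B"
    and frame: "\<And>i j. (\<Sum>b\<in>B. W b i * W b j) = (if i = j then \<kappa> else 0)"
    and "I \<in> tuples k UNIV" "J \<in> tuples k UNIV"
  shows "(\<Sum>b\<in>tuples k B. (\<Prod>j<k. W (b j) (I j)) * (\<Prod>j<k. W (b j) (J j))) =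
    (if I = J then \<kappa> ^ k else 0)"
proof -
  have "(\<Sum>b\<in>tuples k B. (\<Prod>j<k. W (b j) (I j)) * (\<Prod>j<k. W (b j) (J j)))
      = (\<Prod>j<k. \<Sum>b\<in>B. W b (I j) * W b (J j))"
    using assms(1) by (subst prod_sum_PiE) (auto simp: prod.distrib)
  also have "\<dots> = (\<Prod>j<k. if I j = J j then \<kappa> else 0)"
    by (simp add: frame)
  also have "\<dots> = (if I = J then \<kappa> ^ k else 0)"
  proof (cases "I = J")
    case False
    then obtain j where "j < k" "I j \<noteq> J j"
      using assms(3,4) by (metis PiE_ext lessThan_iff)
    then show ?thesis
      using False by (auto intro: prod_zero)
  qed simp
  finally show ?thesis .
qed

section \<open>Tensors with small injective norm\<close>

text \<open>Half of the left side is the mean of exp(s x) over a random sign s, so this is a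
  subgaussian bound. Adding exp y <= 1 + y + y^2 for y = x and y = -x cancels the linear
  terms.\<close>

lemma exp_sum_le:
  assumes "\<bar>x::real\<bar> \<le> 1"
  shows "exp x + exp (- x) \<le> 2 * exp (x\<^sup>2)"
proof -
  have "exp y \<le> 1 + y + y\<^sup>2" if "\<bar>y\<bar> \<le> 1" for y :: real
  proof (cases "y \<ge> 0")
    case True
    then show ?thesis using exp_bound[of y] that by simp
  next
    case False
    \<comment> \<open>For y < 0 the claim is proved for the reciprocal: this lower bound for
      exp(-y), multiplied by 1 + y + y^2, is at least 1.\<close>
    have taylor: "exp (- y) \<ge> 1 + (-y) + (-y)\<^sup>2 / 2"
      using exp_lower_Taylor_quadratic[of "-y"] False by simp
    have nn: "0 \<le> 1 + y + y\<^sup>2" "y\<^sup>2 * (1 / 2 + y\<^sup>2 / 2 - y / 2) \<ge> 0"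
      using False that zero_le_power2[of y] by (linarith, intro mult_nonneg_nonneg) (auto intro: order.trans[of _ 0])
    with taylor nn have *: "exp (- y) * (1 + y + y\<^sup>2) \<ge> (1 - y + y\<^sup>2 / 2) * (1 + y + y\<^sup>2)"
      using nn by (intro mult_right_mono) auto
    have "(1 - y + y\<^sup>2 / 2) * (1 + y + y\<^sup>2) = 1 + y\<^sup>2 * (1 / 2 + y\<^sup>2 / 2 - y / 2)"
      by (simp add: field_simps power2_eq_square)
    then have "exp (- y) * (1 + y + y\<^sup>2) \<ge> 1"
      using * nn by linarith
    then show ?thesis
      by (simp add: exp_minus field_simps)
  qed
  from this[of x] this[of "-x"] have "exp x + exp (- x) \<le> 2 * (1 + x\<^sup>2)"
    using assms by simp
  also have "\<dots> \<le> 2 * exp (x\<^sup>2)"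
    by (intro mult_left_mono exp_ge_add_one_self) simp
  finally show ?thesis .
qed

text \<open>Exponential moments, with counting in place of probability. The mean of exp(g s v) over
  all sign patterns s factors into terms bounded by exp((w v I)^2), so it is at most e, and likewise
  for -g. The sum over V and both signs therefore has mean at most 2 e |V|; a pattern not exceeding
  this mean has every |g s v| at most the logarithm of it.\<close>

lemma exists_signs:
  fixes w :: "'v \<Rightarrow> 'c \<Rightarrow> real"
  assumes "finite \<Omega>" "finite V" "V \<noteq> {}" and w: "\<And>v. v \<in> V \<Longrightarrow> (\<Sum>I\<in>\<Omega>. (w v I)\<^sup>2) \<le> 1"
  obtains s :: "'c \<Rightarrow> real" where "\<And>I. I \<in> \<Omega> \<Longrightarrow> \<bar>s I\<bar> = 1"
    and "\<And>v. v \<in> V \<Longrightarrow> \<bar>\<Sum>I\<in>\<Omega>. s I * w v I\<bar> \<le> 1 + ln (2 * card V)"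
proof -
  define S where "S = Pi\<^sub>E \<Omega> (\<lambda>_. {1, -1::real})"
  define g where "g s v = (\<Sum>I\<in>\<Omega>. s I * w v I)" for s v
  have card_S: "card S = 2 ^ card \<Omega>" and "finite S"
    unfolding S_def using assms(1) by (simp_all add: card_PiE finite_PiE numeral_2_eq_2)
  have S: "(\<Sum>s\<in>S. exp (c * g s v)) \<le> card S * exp 1" if "v \<in> V" "\<bar>c\<bar> = 1" for v c
  proof -
    have le1: "\<bar>w v I\<bar> \<le> 1" if "I \<in> \<Omega>" for I
    proof -
      have "(w v I)\<^sup>2 \<le> (\<Sum>I\<in>\<Omega>. (w v I)\<^sup>2)"
        using assms(1) that by (intro member_le_sum) auto
      then show ?thesis
        using w[OF \<open>v \<in> V\<close>] abs_square_le_1[of "w v I"] by linarith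
    qed
    have c: "c = 1 \<or> c = -1"
      using that(2) by auto
    have "(\<Sum>s\<in>S. exp (c * g s v)) = (\<Sum>s\<in>S. \<Prod>I\<in>\<Omega>. exp (c * s I * w v I))"
      using assms(1) by (simp add: g_def sum_distrib_left exp_sum mult.assoc)
    also have "\<dots> = (\<Prod>I\<in>\<Omega>. \<Sum>t\<in>{1,-1}. exp (c * t * w v I))"
      unfolding S_def using assms(1) by (subst prod_sum_PiE) auto
    also have "\<dots> = (\<Prod>I\<in>\<Omega>. exp (w v I) + exp (- w v I))"
      using c by (elim disjE) (simp_all add: add.commute)
    also have "\<dots> \<le> (\<Prod>I\<in>\<Omega>. 2 * exp ((w v I)\<^sup>2))"
      by (intro prod_mono conjI add_nonneg_nonneg exp_sum_le le1) auto
    also have "\<dots> = card S * exp (\<Sum>I\<in>\<Omega>. (w v I)\<^sup>2)"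
      using assms(1) by (simp add: prod.distrib exp_sum card_S)
    also have "\<dots> \<le> card S * exp 1"
      using w[OF \<open>v \<in> V\<close>] by (intro mult_left_mono) auto
    finally show ?thesis .
  qed
  have "(\<Sum>s\<in>S. \<Sum>v\<in>V. exp (g s v) + exp (- g s v))
      = (\<Sum>v\<in>V. (\<Sum>s\<in>S. exp (1 * g s v)) + (\<Sum>s\<in>S. exp (-1 * g s v)))"
    by (subst sum.swap) (simp add: sum.distrib)
  also have "\<dots> \<le> (\<Sum>v\<in>V. card S * exp 1 + card S * exp 1)"
    by (intro sum_mono add_mono S) auto
  also have "\<dots> = (\<Sum>s\<in>S. 2 * card V * exp 1)"
    by simp
  finally have le: "(\<Sum>s\<in>S. \<Sum>v\<in>V. exp (g s v) + exp (- g s v)) \<le> (\<Sum>s\<in>S. 2 * card V * exp 1)" .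
  have "\<exists>s\<in>S. (\<Sum>v\<in>V. exp (g s v) + exp (- g s v)) \<le> 2 * card V * exp 1"
  proof (rule ccontr)
    assume "\<not> ?thesis"
    then have "(\<Sum>s\<in>S. 2 * card V * exp 1) < (\<Sum>s\<in>S. \<Sum>v\<in>V. exp (g s v) + exp (- g s v))"
      using card_S \<open>finite S\<close> by (intro sum_strict_mono) (auto simp: not_le)
    with le show False by simp
  qed
  then obtain s where s: "s \<in> S" "(\<Sum>v\<in>V. exp (g s v) + exp (- g s v)) \<le> 2 * card V * exp 1"
    by blast
  show thesis
  proof
    show "\<bar>s I\<bar> = 1" if "I \<in> \<Omega>" for I
      using s(1) that by (auto simp: S_def PiE_iff)
    show "\<bar>\<Sum>I\<in>\<Omega>. s I * w v I\<bar> \<le> 1 + ln (2 * card V)" if "v \<in> V" for v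
    proof -
      \<comment> \<open>Both signs of the exponent were summed so that the absolute value is
        controlled.\<close>
      have "exp \<bar>g s v\<bar> \<le> exp (g s v) + exp (- g s v)"
        by (cases "g s v \<ge> 0") auto
      also have "\<dots> \<le> (\<Sum>v\<in>V. exp (g s v) + exp (- g s v))"
        using assms(2) that
        by (intro member_le_sum[of v V "\<lambda>v. exp (g s v) + exp (- g s v)"]) (auto simp: add_nonneg_nonneg)
      also note s(2)
      also have "2 * card V * exp 1 = exp (1 + ln (2 * card V))"
        using assms(2,3) by (simp add: exp_add card_gt_0_iff)
      finally show ?thesis
        by (simp add: g_def)
    qed
  qed
qed

section \<open>Multilinear forms in coordinates and their values on a net\<close>

definition tform ::
    "nat \<Rightarrow> ((nat \<Rightarrow> 'i::finite) \<Rightarrow> 'k::scalar_field) \<Rightarrow> (nat \<Rightarrow> 'k ^ 'i) \<Rightarrow> 'k" where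
  "tform k z u = (\<Sum>I\<in>tuples k UNIV. z I * (\<Prod>j<k. u j $ I j))"

lemma finite_tuples [simp]: "finite A \<Longrightarrow> finite (tuples k A)"
  by (simp add: finite_PiE)

lemma card_tuples: "card (tuples k A) = card A ^ k"
  by (simp add: card_PiE)

lemma tform_cong: "(\<And>j. j < k \<Longrightarrow> u j = v j) \<Longrightarrow> tform k z u = tform k z v"
  by (simp add: tform_def)

lemma tform_scaleR:
  "tform k z (\<lambda>j. r j *\<^sub>R u j) = of_real (\<Prod>j<k. r j) * tform k z u"
proof -
  have "(r j *\<^sub>R u j) $ i = of_real (r j) * u j $ i" for j i
    by (subst vector_scaleR_component) (rule scaleR_conv_of_real)
  then show ?thesis
    by (simp add: tform_def sum_distrib_left prod.distrib mult_ac)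
qed

lemma norm_scaleR_sgn: "norm v *\<^sub>R sgn v = v"
  by (cases "v = 0") (simp_all add: sgn_div_norm)

lemma tform_update:
  assumes "j < k"
  shows "tform k z (u(j := v)) = (\<Sum>I\<in>tuples k UNIV. z I * (\<Prod>i\<in>{..<k} - {j}. u i $ I i) * v $ I j)"
  unfolding tform_def
proof (intro sum.cong refl)
  fix I
  have "(\<Prod>i<k. (u(j := v)) i $ I i) = v $ I j * (\<Prod>i\<in>{..<k} - {j}. (u(j := v)) i $ I i)"
    using assms by (subst prod.remove[of _ j]) auto
  also have "(\<Prod>i\<in>{..<k} - {j}. (u(j := v)) i $ I i) = (\<Prod>i\<in>{..<k} - {j}. u i $ I i)"
    by (intro prod.cong) auto
  finally show "z I * (\<Prod>i<k. (u(j := v)) i $ I i) = z I * (\<Prod>i\<in>{..<k} - {j}. u i $ I i) * v $ I j"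
    by simp
qed

lemma tform_update_diff:
  "j < k \<Longrightarrow> tform k z (u(j := v - w)) = tform k z (u(j := v)) - tform k z (u(j := w))"
  by (simp add: tform_update right_diff_distrib sum_subtractf)

lemma norm_tform_le:
  assumes "\<And>j. j < k \<Longrightarrow> norm (u j) \<le> c"
  shows "norm (tform k z u) \<le> (\<Sum>I\<in>tuples k UNIV. norm (z I)) * c ^ k"
  unfolding tform_def sum_distrib_right
proof (intro sum_norm_le)
  fix I
  have "norm (u j $ I j) \<le> c" if "j < k" for j
    using assms[OF that] Finite_Cartesian_Product.norm_nth_le[of "u j" "I j"] by linarith
  then have "(\<Prod>j<k. norm (u j $ I j)) \<le> (\<Prod>j<k. c)"
    by (intro prod_mono) auto
  then show "norm (z I * (\<Prod>j<k. u j $ I j)) \<le> norm (z I) * c ^ k"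
    by (simp add: norm_mult prod_norm mult_left_mono)
qed

text \<open>Homogeneity in each slot: a vector is its norm times its \<open>sgn\<close>, and
  \<open>sgn 0 = 0\<close> covers zero vectors.\<close>

lemma norm_tform_le_prod:
  assumes "\<And>u. (\<And>j. j < k \<Longrightarrow> norm (u j) \<le> 1) \<Longrightarrow> norm (tform k z u) \<le> T"
  shows "norm (tform k z u) \<le> T * (\<Prod>j<k. norm (u j))"
proof -
  have "tform k z u = tform k z (\<lambda>j. norm (u j) *\<^sub>R sgn (u j))"
    by (intro tform_cong) (simp add: norm_scaleR_sgn)
  also have "norm \<dots> = (\<Prod>j<k. norm (u j)) * norm (tform k z (\<lambda>j. sgn (u j)))"
    by (simp add: tform_scaleR norm_mult abs_of_nonneg prod_nonneg flip: of_real_prod)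
  also have "\<dots> \<le> (\<Prod>j<k. norm (u j)) * T"
    by (intro mult_left_mono assms) (auto simp: prod_nonneg norm_sgn)
  finally show ?thesis
    by (simp add: mult.commute)
qed

text \<open>The slots are released from the net to the unit ball one at a time. In one slot,
  replacing a vector by a net point leaves an error of norm at most \<delta>, so the supremum S over
  the ball satisfies S <= K' + \<delta> S; each slot thus costs a factor 1/(1 - \<delta>).\<close>

lemma tform_net:
  fixes F :: "('k::scalar_field ^ 'i::finite) set"
  assumes net: "\<And>v. norm v \<le> 1 \<Longrightarrow> \<exists>f\<in>F. norm (v - f) \<le> \<delta>"
    and F: "\<And>f. f \<in> F \<Longrightarrow> norm f \<le> 1" and "0 \<le> \<delta>" "\<delta> < 1"
    and K: "\<And>u. (\<And>j. j < k \<Longrightarrow> u j \<in> F) \<Longrightarrow> norm (tform k z u) \<le> K"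
    and u: "\<And>j. j < k \<Longrightarrow> norm (u j) \<le> 1"
  shows "norm (tform k z u) \<le> K / (1 - \<delta>) ^ k"
proof -
  \<comment> \<open>The first \<open>m\<close> slots already range over the ball, the others still
    over the net \<open>F\<close>.\<close>
  have "norm (tform k z u) \<le> K / (1 - \<delta>) ^ m"
    if "m \<le> k" "\<And>j. j < m \<Longrightarrow> norm (u j) \<le> 1" "\<And>j. m \<le> j \<Longrightarrow> j < k \<Longrightarrow> u j \<in> F" for m u
    using that
  proof (induction m arbitrary: u)
    case 0
    then show ?case using K[of u] by simp
  next
    case (Suc m)
    define g where "g v = norm (tform k z (u(m := v)))" for v
    define K' where "K' = K / (1 - \<delta>) ^ m"
    define S where "S = Sup (g ` cball 0 1)"
    have gF: "g f \<le> K'" if "f \<in> F" for f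
      unfolding g_def K'_def
      using Suc.prems that by (intro Suc.IH) (auto simp: less_Suc_eq_le)
    \<comment> \<open>A crude bound, whose purpose is to make \<open>S\<close> a genuine supremum
      before the inequality is solved for it.\<close>
    have "g v \<le> (\<Sum>I\<in>tuples k UNIV. norm (z I)) * 1 ^ k" if "norm v \<le> 1" for v
      unfolding g_def using Suc.prems(2,3) F that by (intro norm_tform_le) (auto simp: not_less[symmetric])
    then have bdd: "bdd_above (g ` cball 0 1)"
      by (intro bdd_aboveI2) auto
    have gS: "g v \<le> S" if "norm v \<le> 1" for v
      unfolding S_def using that bdd by (intro cSUP_upper) auto
    have gS': "g v \<le> \<delta> * S" if "norm v \<le> \<delta>" for v
    proof -
      have "g v = norm v * g (sgn v)"
      proof -
        have "tform k z (u(m := v)) = tform k z (\<lambda>j. (if j = m then norm v else 1) *\<^sub>R (u(m := sgn v)) j)"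
          by (intro tform_cong) (simp add: norm_scaleR_sgn)
        also have "norm \<dots> = norm v * g (sgn v)"
          using Suc.prems(1) unfolding tform_scaleR g_def
          by (simp add: norm_mult fun_upd_def)
        finally show ?thesis by (simp add: g_def)
      qed
      also have "\<dots> \<le> \<delta> * S"
        using gS[of "sgn v"] gS[of 0] that assms(3) by (intro mult_mono) (auto simp: norm_sgn g_def)
      finally show ?thesis .
    qed
    have "S \<le> K' + \<delta> * S"
      unfolding S_def
    proof (rule cSUP_least, simp, fold S_def)
      fix v :: "'k ^ 'i" assume "v \<in> cball 0 1"
      then obtain f where f: "f \<in> F" "norm (v - f) \<le> \<delta>"
        using net[of v] by auto
      have "tform k z (u(m := v)) = tform k z (u(m := f)) + tform k z (u(m := v - f))"
        using Suc.prems(1) by (simp add: tform_update_diff)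
      then have "g v \<le> g f + g (v - f)"
        unfolding g_def by (metis norm_triangle_ineq)
      then show "g v \<le> K' + \<delta> * S"
        using gF[OF f(1)] gS'[OF f(2)] by linarith
    qed
    then have "S \<le> K' / (1 - \<delta>)"
      using assms(4) by (simp add: field_simps)
    moreover have "norm (tform k z u) \<le> S"
      using gS[of "u m"] Suc.prems(2)[of m] by (simp add: g_def)
    ultimately show ?case
      by (simp add: K'_def mult.commute)
  qed
  from this[of k u] u show ?thesis by simp
qed

lemma norm_sq_prod_tuples:
  fixes u :: "nat \<Rightarrow> 'k::scalar_field ^ 'i::finite"
  shows "(\<Sum>I\<in>tuples k UNIV. (norm (\<Prod>j<k. u j $ I j))\<^sup>2) = (\<Prod>j<k. (norm (u j))\<^sup>2)"
proof -
  have "(norm (u j))\<^sup>2 = (\<Sum>i\<in>UNIV. (norm (u j $ i))\<^sup>2)" for j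
    by (simp add: norm_vec_def L2_set_def sum_nonneg)
  then show ?thesis
    by (simp add: prod_sum_PiE prod_norm[symmetric] prod_power_distrib)
qed

text \<open>The net depends on \<open>\<delta>\<close> but not on \<open>k\<close>, so the number of product vectors in the union bound is
  only exponential in \<open>k\<close>.\<close>

lemma exists_tensor_small_injective:
  assumes "0 < \<delta>" "\<delta> < 1"
  obtains C where "0 < C" and
    "\<And>k. 1 \<le> k \<Longrightarrow> \<exists>s :: (nat \<Rightarrow> 'i::finite) \<Rightarrow> real. (\<forall>I\<in>tuples k UNIV. \<bar>s I\<bar> = 1) \<and>
      (\<forall>u :: nat \<Rightarrow> 'k::scalar_field ^ 'i. (\<forall>j<k. norm (u j) \<le> 1) \<longrightarrow>
        norm (tform k (\<lambda>I. of_real (s I)) u) \<le> C * k / (1 - \<delta>) ^ k)"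
proof -
  have "compact (cball (0 :: 'k ^ 'i) 1)"
    by simp
  then obtain F :: "('k ^ 'i) set" where F: "F \<subseteq> cball 0 1" "finite F" "cball 0 1 \<subseteq> (\<Union>x\<in>F. ball x \<delta>)"
    by (rule compactE_image[where C = "cball 0 1" and f = "\<lambda>x. ball x \<delta>"])
      (use assms(1) in force)+
  have net: "\<exists>f\<in>F. norm (v - f) \<le> \<delta>" if "norm v \<le> 1" for v
    using F(3) that by (force simp: dist_norm norm_minus_commute)
  have "F \<noteq> {}"
    using net[of 0] by auto
  then have card1: "1 \<le> card F"
    using F(2) by (simp add: Suc_le_eq card_gt_0_iff)
  \<comment> \<open>The 4 combines the 2 in \<open>exists_signs\<close> with the two values of the
    boolean in \<open>V\<close>; the outer 2 comes from adding the estimates for the real and the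
    imaginary part.\<close>
  define C where "C = 2 * (1 + ln 4 + ln (card F))"
  have "C > 0"
    using card1 by (simp add: C_def add_pos_nonneg)
  moreover have "\<exists>s :: (nat \<Rightarrow> 'i) \<Rightarrow> real. (\<forall>I\<in>tuples k UNIV. \<bar>s I\<bar> = 1) \<and>
      (\<forall>u :: nat \<Rightarrow> 'k ^ 'i. (\<forall>j<k. norm (u j) \<le> 1) \<longrightarrow>
        norm (tform k (\<lambda>I. of_real (s I)) u) \<le> C * k / (1 - \<delta>) ^ k)" if "1 \<le> k" for k
  proof -
    \<comment> \<open>\<open>exists_signs\<close> speaks of real vectors, so every product vector
      enters twice, through its real and its imaginary part.\<close>
    define w where "w = (\<lambda>(u :: nat \<Rightarrow> 'k ^ 'i, b) I.
      (if b then Re (emb (\<Prod>j<k. u j $ I j)) else Im (emb (\<Prod>j<k. u j $ I j))))"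
    define V where "V = tuples k F \<times> (UNIV :: bool set)"
    have w1: "(\<Sum>I\<in>tuples k UNIV. (w v I)\<^sup>2) \<le> 1" if "v \<in> V" for v
    proof -
      obtain u b where v: "v = (u, b)" by (cases v)
      have "(w v I)\<^sup>2 \<le> (norm (\<Prod>j<k. u j $ I j))\<^sup>2" for I
        by (simp add: v w_def norm_sq_emb)
      then have "(\<Sum>I\<in>tuples k UNIV. (w v I)\<^sup>2) \<le> (\<Prod>j<k. (norm (u j))\<^sup>2)"
        unfolding norm_sq_prod_tuples[symmetric] by (intro sum_mono)
      also have "\<dots> \<le> (\<Prod>j<k. 1)"
        using that F(1) by (intro prod_mono) (auto simp: V_def v PiE_iff power_le_one)
      finally show ?thesis by simp
    qed
    have "finite V" "V \<noteq> {}"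
      using F(2) \<open>F \<noteq> {}\<close> by (auto simp: V_def PiE_eq_empty_iff)
    from exists_signs[of "tuples k UNIV" V w, OF _ this w1]
    obtain s where s: "\<And>I. I \<in> tuples k UNIV \<Longrightarrow> \<bar>s I\<bar> = 1"
      "\<And>v. v \<in> V \<Longrightarrow> \<bar>\<Sum>I\<in>tuples k UNIV. s I * w v I\<bar> \<le> 1 + ln (2 * card V)"
      by auto
    have "2 * real (card V) = 4 * real (card F) ^ k"
      by (simp add: V_def card_cartesian_product card_tuples)
    then have "1 + ln (2 * card V) = 1 + ln 4 + k * ln (card F)"
      using card1 by (simp add: ln_mult ln_realpow)
    also have "\<dots> \<le> C / 2 * k"
      using \<open>1 \<le> k\<close> by (simp add: C_def algebra_simps add_mono)
    finally have card: "1 + ln (2 * card V) \<le> C / 2 * k" .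
    have K: "norm (tform k (\<lambda>I. of_real (s I)) u) \<le> C * k" if u: "\<And>j. j < k \<Longrightarrow> u j \<in> F" for u
    proof -
      \<comment> \<open>Restriction leaves the value of the form unchanged and turns
        \<open>u\<close> into an extensional tuple, which \<open>V\<close> covers.\<close>
      define u' where "u' = restrict u {..<k}"
      have u': "(u', b) \<in> V" for b
        using u by (auto simp: V_def u'_def)
      have "norm (tform k (\<lambda>I. of_real (s I)) u) = norm (tform k (\<lambda>I. of_real (s I)) u')"
        by (simp add: u'_def tform_def)
      also have "\<dots> = sqrt ((\<Sum>I\<in>tuples k UNIV. s I * w (u', True) I)\<^sup>2 +
          (\<Sum>I\<in>tuples k UNIV. s I * w (u', False) I)\<^sup>2)"
        unfolding tform_def w_def by (simp add: norm_sum_of_real_mult[symmetric])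
      also have "\<dots> \<le> \<bar>\<Sum>I\<in>tuples k UNIV. s I * w (u', True) I\<bar> + \<bar>\<Sum>I\<in>tuples k UNIV. s I * w (u', False) I\<bar>"
        by (rule sqrt_sum_squares_le_sum_abs)
      also have "\<dots> \<le> C * k"
        using s(2)[OF u'[of True]] s(2)[OF u'[of False]] card by linarith
      finally show ?thesis .
    qed
    show ?thesis
    proof (intro exI[of _ s] conjI ballI allI impI s(1))
      fix u :: "nat \<Rightarrow> 'k ^ 'i" assume "\<forall>j<k. norm (u j) \<le> 1"
      then show "norm (tform k (\<lambda>I. of_real (s I)) u) \<le> C * k / (1 - \<delta>) ^ k"
        using F(1) assms(1) by (intro tform_net[OF net _ _ assms(2) K]) auto
    qed
  qed
  ultimately show thesis
    using that by blast
qed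

section \<open>Tensors in coordinates\<close>

abbreviation functional ::
    "('k::scalar_field \<Rightarrow> 'v::ab_group_add \<Rightarrow> 'v) \<Rightarrow> ('v \<Rightarrow> 'k) \<Rightarrow> bool" where
  "functional s \<equiv> Vector_Spaces.linear s times"

text \<open>A choice of basis. Spaces of matrices fit as well, with pairs as index type. The
  Euclidean norm on X is the norm of \<open>co x\<close>.\<close>

locale coordinates =
  fixes s :: "'k::scalar_field \<Rightarrow> 'v::ab_group_add \<Rightarrow> 'v"
    and co :: "'v \<Rightarrow> 'k ^ 'i::finite"
  assumes linear_co: "Vector_Spaces.linear s (*s) co" and bij_co: "bij co"
begin

sublocale co: Vector_Spaces.linear s "(*s)" co
  by (rule linear_co)

definition ve :: "'k ^ 'i \<Rightarrow> 'v" where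
  "ve = inv co"

lemma co_ve [simp]: "co (ve a) = a"
  unfolding ve_def using bij_co by (simp add: bij_is_surj surj_f_inv_f)

lemma co_inject: "co x = co y \<longleftrightarrow> x = y"
  using bij_co by (auto dest: bij_is_inj injD)

definition fvec :: "('v \<Rightarrow> 'k) \<Rightarrow> 'k ^ 'i" where
  "fvec \<phi> = (\<chi> i. \<phi> (ve (axis i 1)))"

text \<open>The pairing is bilinear, without conjugation, so that linear functionals have coordinate
  vectors over both fields; \<open>fvec\<close> recovers them.\<close>

definition fun_of :: "'k ^ 'i \<Rightarrow> 'v \<Rightarrow> 'k" where
  "fun_of a x = (\<Sum>i\<in>UNIV. co x $ i * a $ i)"

lemma functional_eq:
  assumes "functional s \<phi>"
  shows "\<phi> x = fun_of (fvec \<phi>) x"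
proof -
  interpret \<phi>: Vector_Spaces.linear s times \<phi> by (rule assms)
  have "co x = co (\<Sum>i\<in>UNIV. s (co x $ i) (ve (axis i 1)))"
    by (simp add: co.sum co.scale basis_expansion)
  then have "x = (\<Sum>i\<in>UNIV. s (co x $ i) (ve (axis i 1)))"
    by (simp only: co_inject)
  then have "\<phi> x = \<phi> (\<Sum>i\<in>UNIV. s (co x $ i) (ve (axis i 1)))"
    by (rule arg_cong)
  then show ?thesis
    by (simp add: \<phi>.sum \<phi>.scale fun_of_def fvec_def)
qed

lemma functional_fun_of: "functional s (fun_of a)"
  by unfold_locales
    (simp_all add: fun_of_def co.add co.scale algebra_simps sum.distrib sum_distrib_left)

lemma fvec_fun_of [simp]: "fvec (fun_of a) = a"
  by (simp add: fvec_def fun_of_def vec_eq_iff axis_def if_distrib[of "\<lambda>x. x * _"] cong: if_cong)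

text \<open>The default 0 copies that of \<open>elem_tensor\<close>, so that identities between
  tensors hold as equalities of functions on all lists.\<close>

definition tens :: "nat \<Rightarrow> ((nat \<Rightarrow> 'i) \<Rightarrow> 'k) \<Rightarrow> ('v \<Rightarrow> 'k) list \<Rightarrow> 'k" where
  "tens k z \<phi>s = (if length \<phi>s = k \<and> (\<forall>\<phi>\<in>set \<phi>s. functional s \<phi>)
     then tform k z (\<lambda>j. fvec (\<phi>s ! j)) else 0)"

lemma tens_fun_of: "tens k z (map (\<lambda>j. fun_of (u j)) [0..<k]) = tform k z u"
  by (auto simp: tens_def functional_fun_of intro: tform_cong)

lemma elem_tensor_eq:
  "elem_tensor s xs = tens (length xs) (\<lambda>I. \<Prod>j<length xs. co (xs ! j) $ I j)"
proof
  fix \<phi>s :: "('v \<Rightarrow> 'k) list"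
  show "elem_tensor s xs \<phi>s = tens (length xs) (\<lambda>I. \<Prod>j<length xs. co (xs ! j) $ I j) \<phi>s"
  proof (cases "length \<phi>s = length xs \<and> (\<forall>\<phi>\<in>set \<phi>s. functional s \<phi>)")
    case True
    then have "(\<phi>s ! j) (xs ! j) = fun_of (fvec (\<phi>s ! j)) (xs ! j)" if "j < length xs" for j
      using that by (intro functional_eq) auto
    then have "(\<Prod>j<length xs. (\<phi>s ! j) (xs ! j)) = (\<Prod>j<length xs. fun_of (fvec (\<phi>s ! j)) (xs ! j))"
      by simp
    also have "\<dots> = tform (length xs) (\<lambda>I. \<Prod>j<length xs. co (xs ! j) $ I j) (\<lambda>j. fvec (\<phi>s ! j))"
      by (simp add: fun_of_def tform_def prod_sum_PiE prod.distrib)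
    finally show ?thesis
      using True by (simp add: elem_tensor_def tens_def)
  qed (auto simp: elem_tensor_def tens_def)
qed

lemma tens_sum:
  "(\<Sum>a\<in>A. c a * tens k (z a) \<phi>s) = tens k (\<lambda>I. \<Sum>a\<in>A. c a * z a I) \<phi>s"
proof -
  have "(\<Sum>a\<in>A. c a * tform k (z a) u) = tform k (\<lambda>I. \<Sum>a\<in>A. c a * z a I) u" for u
    by (simp add: tform_def sum_distrib_left sum_distrib_right mult.assoc sum.swap[of _ _ A])
  moreover have "(\<forall>y. tens k y \<phi>s = tform k y (\<lambda>j. fvec (\<phi>s ! j))) \<or> (\<forall>y. tens k y \<phi>s = 0)"
    by (simp add: tens_def)
  ultimately show ?thesis
    by (elim disjE) simp_all
qed

lemma tens_cong: "(\<And>I. I \<in> tuples k UNIV \<Longrightarrow> z I = z' I) \<Longrightarrow> tens k z = tens k z'"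
  by (simp add: tens_def tform_def fun_eq_iff)

lemma axis_sym: "axis i 1 $ j = axis j 1 $ i"
  by (simp add: axis_def)

text \<open>Evaluation at basis vectors reads off a coordinate; this is why \<open>tens k z\<close>
  determines \<open>z\<close> on \<open>tuples k UNIV\<close>.\<close>

lemma tform_axis:
  fixes z :: "(nat \<Rightarrow> 'i) \<Rightarrow> 'k"
  assumes "I \<in> tuples k UNIV"
  shows "tform k z (\<lambda>j. axis (I j) 1) = z I"
proof -
  have *: "(\<Prod>j<k. axis (I j) (1::'k) $ J j) = (if J = I then 1 else 0)" if J: "J \<in> tuples k UNIV" for J
  proof (cases "J = I")
    case False
    then obtain j where j: "j < k" "J j \<noteq> I j"
      using PiE_ext[OF J assms] by auto
    then have "(\<Prod>j<k. axis (I j) (1::'k) $ J j) = 0"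
      by (intro prod_zero) (auto simp: axis_def)
    then show ?thesis
      using False by simp
  qed (simp add: axis_def)
  have "tform k z (\<lambda>j. axis (I j) 1) = (\<Sum>J\<in>tuples k UNIV. if J = I then z J else 0)"
    unfolding tform_def by (intro sum.cong) (simp_all add: * del: prod_zero_iff)
  then show ?thesis
    using assms by simp
qed

lemma tens_eqD:
  assumes "tens k z = tens k z'" "I \<in> tuples k UNIV"
  shows "z I = z' I"
  using tens_fun_of[of k z "\<lambda>j. axis (I j) 1"] tens_fun_of[of k z' "\<lambda>j. axis (I j) 1"] assms
  by (simp add: tform_axis)

lemma tens_0: "tens k (\<lambda>_. 0) = (\<lambda>_. 0)"
  by (simp add: tens_def tform_def fun_eq_iff)

lemma tens_eq_sum_elem:
  assumes "finite A" and len: "\<And>a. a \<in> A \<Longrightarrow> length (xs a) = k"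
  shows "(\<lambda>\<phi>s. \<Sum>a\<in>A. c a * elem_tensor s (xs a) \<phi>s) =
    tens k (\<lambda>I. \<Sum>a\<in>A. c a * (\<Prod>j<k. co (xs a ! j) $ I j))"
proof
  fix \<phi>s
  have "(\<Sum>a\<in>A. c a * elem_tensor s (xs a) \<phi>s) = (\<Sum>a\<in>A. c a * tens k (\<lambda>I. \<Prod>j<k. co (xs a ! j) $ I j) \<phi>s)"
    by (intro sum.cong refl) (simp add: elem_tensor_eq len)
  then show "(\<Sum>a\<in>A. c a * elem_tensor s (xs a) \<phi>s) =
      tens k (\<lambda>I. \<Sum>a\<in>A. c a * (\<Prod>j<k. co (xs a ! j) $ I j)) \<phi>s"
    by (simp add: tens_sum)
qed

text \<open>Expansion in the basis tensors. As \<open>tensor_power\<close> sums over an initial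
  segment of the naturals, the index tuples are enumerated by \<open>h\<close>.\<close>

lemma tens_in_tensor_power: "tens k z \<in> tensor_power s k"
proof -
  obtain h where h: "bij_betw h {0..<card (tuples k (UNIV :: 'i set))} (tuples k (UNIV :: 'i set))"
    using ex_bij_betw_nat_finite[of "tuples k (UNIV :: 'i set)"] by auto
  let ?m = "card (tuples k (UNIV :: 'i set))"
  define xs where "xs I = map (\<lambda>j. ve (axis (I j) 1)) [0..<k]" for I :: "nat \<Rightarrow> 'i"
  have "(\<Sum>i<?m. z (h i) * (\<Prod>j<k. co (xs (h i) ! j) $ I j)) = z I" if I: "I \<in> tuples k UNIV" for I
  proof -
    have "(\<Sum>i<?m. z (h i) * (\<Prod>j<k. co (xs (h i) ! j) $ I j))
        = (\<Sum>J\<in>tuples k UNIV. z J * (\<Prod>j<k. co (xs J ! j) $ I j))"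
      using sum.reindex_bij_betw[OF h, of "\<lambda>J. z J * (\<Prod>j<k. co (xs J ! j) $ I j)"]
      by (simp add: atLeast0LessThan)
    also have "\<dots> = tform k z (\<lambda>j. axis (I j) 1)"
      by (simp add: tform_def xs_def axis_sym)
    finally show ?thesis
      using I by (simp add: tform_axis)
  qed
  then have "tens k z = (\<lambda>\<phi>s. \<Sum>i<?m. z (h i) * elem_tensor s (xs (h i)) \<phi>s)"
    by (subst tens_eq_sum_elem[where k = k]) (auto simp: xs_def intro!: tens_cong)
  then show ?thesis
    unfolding tensor_power_def
    by (intro CollectI exI[of _ ?m] exI[of _ "\<lambda>i. xs (h i)"] exI[of _ "\<lambda>i. z (h i)"])
      (simp add: xs_def)
qed

lemma tensor_power_eq: "tensor_power s k = range (tens k)"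
proof
  show "range (tens k) \<subseteq> tensor_power s k"
    using tens_in_tensor_power by auto
  show "tensor_power s k \<subseteq> range (tens k)"
  proof
    fix z assume "z \<in> tensor_power s k"
    then obtain m :: nat and xs c where "\<forall>i<m. length (xs i) = k"
      "z = (\<lambda>\<phi>s. \<Sum>i<m. c i * elem_tensor s (xs i) \<phi>s)"
      by (auto simp: tensor_power_def)
    then show "z \<in> range (tens k)"
      using tens_eq_sum_elem[of "{..<m}" xs k c] by auto
  qed
qed

end

section \<open>Norms with tight frames in both unit balls\<close>

text \<open>\<open>G\<close> is the frame in the unit ball of X and \<open>F\<close> the one in the
  dual ball. The equalities \<open>G_norm\<close> and \<open>F_norm\<close> express extremality: no
  vector of the unit ball is longer than \<open>c'\<close> by \<open>norm_co_le\<close>, and no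
  functional of the dual ball is longer than \<open>c\<close> by \<open>N_le\<close>.\<close>

locale framed_norm = coordinates s co
  for s :: "'k::scalar_field \<Rightarrow> 'v::ab_group_add \<Rightarrow> 'v" and co :: "'v \<Rightarrow> 'k ^ 'i::finite" +
  fixes N :: "'v \<Rightarrow> real" and c c' \<kappa> \<kappa>' :: real
    and A :: "'a set" and G :: "'a \<Rightarrow> 'i \<Rightarrow> real"
    and B :: "'b set" and F :: "'b \<Rightarrow> 'i \<Rightarrow> real"
  assumes N_nonneg: "0 \<le> N x" and N_scale: "N (s r x) = norm r * N x"
    and c_pos: "0 < c" and c'_pos: "0 < c'"
    and norm_co_le: "norm (co x) \<le> c' * N x" and N_le: "N x \<le> c * norm (co x)"
    and A: "finite A" "A \<noteq> {}" and B: "finite B" "B \<noteq> {}"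
    and G_ball: "a \<in> A \<Longrightarrow> N (ve (\<chi> i. of_real (G a i))) \<le> 1"
    and G_norm: "a \<in> A \<Longrightarrow> (\<Sum>i\<in>UNIV. (G a i)\<^sup>2) = c'\<^sup>2"
    and G_frame: "(\<Sum>a\<in>A. G a i * G a j) = (if i = j then \<kappa>' else 0)"
    and F_ball: "b \<in> B \<Longrightarrow> norm (fun_of (\<chi> i. of_real (F b i)) x) \<le> N x"
    and F_norm: "b \<in> B \<Longrightarrow> (\<Sum>i\<in>UNIV. (F b i)\<^sup>2) = c\<^sup>2"
    and F_frame: "(\<Sum>b\<in>B. F b i * F b j) = (if i = j then \<kappa> else 0)"
begin

text \<open>The trace of the frame operator, computed once over coordinates and once over frame
  vectors.\<close>

lemma frame_constant:
  fixes H :: "'c \<Rightarrow> 'i \<Rightarrow> real" and r q :: real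
  assumes "\<And>i j. (\<Sum>a\<in>C. H a i * H a j) = (if i = j then r else 0)"
    and "\<And>a. a \<in> C \<Longrightarrow> (\<Sum>i\<in>UNIV. (H a i)\<^sup>2) = q"
  shows "r * CARD('i) = card C * q"
proof -
  have "r * CARD('i) = (\<Sum>i\<in>(UNIV :: 'i set). \<Sum>a\<in>C. (H a i)\<^sup>2)"
    by (simp add: power2_eq_square assms(1))
  also have "\<dots> = card C * q"
    by (subst sum.swap) (simp add: assms(2))
  finally show ?thesis .
qed

lemma \<kappa>_eq: "\<kappa> * CARD('i) = card B * c\<^sup>2"
  by (rule frame_constant[OF F_frame F_norm])

lemma \<kappa>'_eq: "\<kappa>' * CARD('i) = card A * c'\<^sup>2"
  by (rule frame_constant[OF G_frame G_norm])

lemma \<kappa>_pos: "0 < \<kappa>"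
proof -
  have "0 < \<kappa> * CARD('i)"
    using B c_pos by (simp add: \<kappa>_eq card_gt_0_iff)
  then show ?thesis by (simp add: zero_less_mult_iff)
qed

lemma \<kappa>'_pos: "0 < \<kappa>'"
proof -
  have "0 < \<kappa>' * CARD('i)"
    using A c'_pos by (simp add: \<kappa>'_eq card_gt_0_iff)
  then show ?thesis by (simp add: zero_less_mult_iff)
qed

lemma dual_ball_norm:
  assumes "\<phi> \<in> dual_ball s N"
  shows "norm (fvec \<phi>) \<le> c"
proof (cases "fvec \<phi> = 0")
  case True
  then show ?thesis using c_pos by simp
next
  case False
  define a where "a = fvec \<phi>"
  have lin: "functional s \<phi>" and ball: "\<And>x. N x \<le> 1 \<Longrightarrow> norm (\<phi> x) \<le> 1"
    using assms by (auto simp: dual_ball_def)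
  interpret \<phi>: Vector_Spaces.linear s times \<phi> by (rule lin)
  \<comment> \<open>At the conjugate of its own coordinate vector \<phi> takes the squared Euclidean
    norm as value; \<open>N_le\<close> and homogeneity turn this into the bound.\<close>
  define x where "x = ve (\<chi> i. conjugate (a $ i))"
  have a_pos: "0 < norm a" using False by (simp add: a_def)
  have "\<phi> x = (\<Sum>i\<in>UNIV. of_real ((norm (a $ i))\<^sup>2))"
    by (simp add: functional_eq[OF lin] fun_of_def x_def a_def mult.commute[of "conjugate _"]
        mult_conjugate_eq_norm del: of_real_power)
  also have "\<dots> = of_real ((norm a)\<^sup>2)"
    by (simp add: norm_vec_def L2_set_def sum_nonneg flip: of_real_sum of_real_power)
  finally have \<phi>x: "\<phi> x = of_real ((norm a)\<^sup>2)" .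
  have "norm (co x) = norm a"
    by (simp add: x_def norm_vec_def)
  then have "N x \<le> c * norm a"
    using N_le[of x] by simp
  then have "N (s (of_real (1 / (c * norm a))) x) \<le> 1"
    using c_pos a_pos by (simp add: N_scale norm_mult norm_divide field_simps del: of_real_mult of_real_divide)
  from ball[OF this] have "norm (of_real (1 / (c * norm a)) * \<phi> x) \<le> 1"
    by (simp only: \<phi>.scale)
  then have "1 / (c * norm a) * (norm a)\<^sup>2 \<le> 1"
    using c_pos a_pos unfolding \<phi>x by (simp only: norm_mult norm_of_real abs_of_nonneg) simp
  then show ?thesis
    using c_pos a_pos by (simp add: a_def[symmetric] field_simps power2_eq_square)
qed

abbreviation "F_vec b \<equiv> (\<chi> i. of_real (F b i)) :: 'k ^ 'i"
abbreviation "G_vec a \<equiv> (\<chi> i. of_real (G a i)) :: 'k ^ 'i"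

lemma fun_of_F: "b \<in> B \<Longrightarrow> fun_of (F_vec b) \<in> dual_ball s N"
  unfolding dual_ball_def
  by (intro CollectI conjI allI impI functional_fun_of order.trans[OF F_ball])

text \<open>The point is that the supremum is over a bounded set, which follows from
  \<open>dual_ball_norm\<close> and the crude estimate \<open>norm_tform_le\<close>.\<close>

lemma norm_tens_le_injective:
  assumes "length \<phi>s = k" "set \<phi>s \<subseteq> dual_ball s N"
  shows "norm (tens k z \<phi>s) \<le> injective_norm s N k (tens k z)"
  unfolding injective_norm_def
proof (rule cSup_upper)
  show "bdd_above {norm (tens k z \<phi>s) |\<phi>s. length \<phi>s = k \<and> set \<phi>s \<subseteq> dual_ball s N}"
  proof (intro bdd_aboveI)
    fix r assume "r \<in> {norm (tens k z \<phi>s) |\<phi>s. length \<phi>s = k \<and> set \<phi>s \<subseteq> dual_ball s N}"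
    then obtain \<phi>s where \<phi>s: "r = norm (tens k z \<phi>s)" "length \<phi>s = k" "set \<phi>s \<subseteq> dual_ball s N"
      by auto
    have "norm (tform k z (\<lambda>j. fvec (\<phi>s ! j))) \<le> (\<Sum>I\<in>tuples k UNIV. norm (z I)) * c ^ k"
      using \<phi>s by (intro norm_tform_le dual_ball_norm) auto
    then show "r \<le> (\<Sum>I\<in>tuples k UNIV. norm (z I)) * c ^ k"
      using c_pos by (auto simp: \<phi>s(1) tens_def sum_nonneg)
  qed
qed (use assms in auto)

lemma injective_norm_nonneg: "0 \<le> injective_norm s N k (tens k z)"
proof -
  obtain b where "b \<in> B" using B by auto
  then have "set (replicate k (fun_of (F_vec b))) \<subseteq> dual_ball s N"
    using fun_of_F by auto
  from norm_tens_le_injective[OF _ this, of k z] show ?thesis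
    by (simp add: order.trans[OF norm_ge_zero])
qed

text \<open>The dual ball lies in the Euclidean ball of radius \<open>c\<close>, so each slot costs
  a factor \<open>c\<close>. A frame functional shows that the supremum is over a nonempty
  set.\<close>

lemma injective_norm_le:
  assumes T: "\<And>u. (\<And>j. j < k \<Longrightarrow> norm (u j) \<le> 1) \<Longrightarrow> norm (tform k z u) \<le> T"
  shows "injective_norm s N k (tens k z) \<le> T * c ^ k"
  unfolding injective_norm_def
proof (rule cSup_least)
  obtain b where "b \<in> B" using B by auto
  then have "set (replicate k (fun_of (F_vec b))) \<subseteq> dual_ball s N"
    using fun_of_F by auto
  then show "{norm (tens k z \<phi>s) |\<phi>s. length \<phi>s = k \<and> set \<phi>s \<subseteq> dual_ball s N} \<noteq> {}"
    by (auto intro: exI[of _ "replicate k (fun_of (F_vec b))"])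
next
  fix r assume "r \<in> {norm (tens k z \<phi>s) |\<phi>s. length \<phi>s = k \<and> set \<phi>s \<subseteq> dual_ball s N}"
  then obtain \<phi>s where \<phi>s: "r = norm (tens k z \<phi>s)" "length \<phi>s = k" "set \<phi>s \<subseteq> dual_ball s N"
    by auto
  have "T \<ge> 0"
    using order.trans[OF norm_ge_zero T[of "\<lambda>_. 0"]] by simp
  have "norm (tform k z (\<lambda>j. fvec (\<phi>s ! j))) \<le> T * (\<Prod>j<k. norm (fvec (\<phi>s ! j)))"
    by (rule norm_tform_le_prod[OF T])
  also have "\<dots> \<le> T * (\<Prod>j<k. c)"
    using \<phi>s(2,3) \<open>T \<ge> 0\<close> by (intro mult_left_mono prod_mono conjI dual_ball_norm) auto
  finally have "norm (tform k z (\<lambda>j. fvec (\<phi>s ! j))) \<le> T * c ^ k"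
    by simp
  then show "r \<le> T * c ^ k"
    using \<open>T \<ge> 0\<close> c_pos by (auto simp: \<phi>s(1) tens_def)
qed

lemma tform_of_real:
  "tform k z (\<lambda>j. \<chi> i. of_real (H (b j) i)) =
    (\<Sum>I\<in>tuples k UNIV. of_real (\<Prod>j<k. H (b j) (I j)) * z I)"
  by (simp add: tform_def mult.commute)

lemma sum_norm_tform_frame:
  fixes H :: "'c \<Rightarrow> 'i \<Rightarrow> real" and z :: "(nat \<Rightarrow> 'i) \<Rightarrow> 'k"
  assumes "finite C" "\<And>i j. (\<Sum>a\<in>C. H a i * H a j) = (if i = j then r else 0)"
  shows "(\<Sum>b\<in>tuples k C. (norm (tform k z (\<lambda>j. \<chi> i. of_real (H (b j) i))))\<^sup>2) =
    r ^ k * (\<Sum>I\<in>tuples k UNIV. (norm (z I))\<^sup>2)"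
  unfolding tform_of_real
  by (rule frame_norm) (simp_all add: frame_tuples[OF assms])

lemma sum_norm_le_injective:
  "(\<Sum>I\<in>tuples k UNIV. (norm (z I))\<^sup>2) \<le>
    (CARD('i) / c\<^sup>2) ^ k * (injective_norm s N k (tens k z))\<^sup>2"
proof -
  let ?e = "injective_norm s N k (tens k z)"
  have le: "norm (tform k z (\<lambda>j. F_vec (b j))) \<le> ?e" if "b \<in> tuples k B" for b
  proof -
    have "fun_of (F_vec (b j)) \<in> dual_ball s N" if "j < k" for j
      using PiE_mem[OF \<open>b \<in> tuples k B\<close>, of j] that by (intro fun_of_F) simp
    then have "norm (tens k z (map (\<lambda>j. fun_of (F_vec (b j))) [0..<k])) \<le> ?e"
      by (intro norm_tens_le_injective) auto
    then show ?thesis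
      by (simp only: tens_fun_of)
  qed
  have "\<kappa> ^ k * (\<Sum>I\<in>tuples k UNIV. (norm (z I))\<^sup>2) \<le> (\<Sum>b\<in>tuples k B. ?e\<^sup>2)"
    unfolding sum_norm_tform_frame[OF B(1) F_frame, symmetric]
    by (intro sum_mono power_mono le) auto
  also have "\<dots> = real (card B) ^ k * ?e\<^sup>2"
    by (simp add: card_tuples)
  finally have "(\<Sum>I\<in>tuples k UNIV. (norm (z I))\<^sup>2) \<le> (card B / \<kappa>) ^ k * ?e\<^sup>2"
    using \<kappa>_pos by (simp add: field_simps)
  \<comment> \<open>The trace identity removes the size of the frame from the bound.\<close>
  also have "card B / \<kappa> = CARD('i) / c\<^sup>2"
    using \<kappa>_eq \<kappa>_pos c_pos by (simp add: field_simps)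
  finally show ?thesis .
qed

text \<open>\<open>projective_norm\<close> admits no coefficients in front of elementary tensors, so
  the weight \<open>w a\<close> is absorbed into the first factor, which exists because
  \<open>1 \<le> k\<close>; homogeneity of \<open>N\<close> returns it as
  \<open>norm (w a)\<close>.\<close>

lemma elementary_decomposition:
  assumes "finite C" "1 \<le> k"
  obtains m :: nat and xs where "\<And>i. i < m \<Longrightarrow> length (xs i) = k"
    and "tens k (\<lambda>I. \<Sum>a\<in>C. w a * (\<Prod>j<k. co (x a j) $ I j)) = (\<lambda>\<phi>s. \<Sum>i<m. elem_tensor s (xs i) \<phi>s)"
    and "(\<Sum>i<m. \<Prod>j<k. N (xs i ! j)) = (\<Sum>a\<in>C. norm (w a) * (\<Prod>j<k. N (x a j)))"
proof -
  obtain h where h: "bij_betw h {0..<card C} C"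
    using ex_bij_betw_nat_finite[OF assms(1)] by auto
  define xs where "xs a = map (\<lambda>j. if j = 0 then s (w a) (x a j) else x a j) [0..<k]" for a
  have split: "(\<Prod>j<k. f j) = f 0 * (\<Prod>j\<in>{..<k} - {0}. f j)" for f :: "nat \<Rightarrow> 'm::comm_monoid_mult"
    using assms(2) by (subst prod.remove[of _ 0]) auto
  have N: "(\<Prod>j<k. N (xs a ! j)) = norm (w a) * (\<Prod>j<k. N (x a j))" for a
    unfolding split[of "\<lambda>j. N (xs a ! j)"] split[of "\<lambda>j. N (x a j)"]
    using assms(2) by (simp add: xs_def N_scale)
  have co: "(\<Prod>j<k. co (xs a ! j) $ I j) = w a * (\<Prod>j<k. co (x a j) $ I j)" for a I
    unfolding split[of "\<lambda>j. co (xs a ! j) $ I j"] split[of "\<lambda>j. co (x a j) $ I j"]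
    using assms(2) by (simp add: xs_def co.scale)
  have "(\<lambda>\<phi>s. \<Sum>i<card C. elem_tensor s (xs (h i)) \<phi>s) =
      tens k (\<lambda>I. \<Sum>i<card C. (\<Prod>j<k. co (xs (h i) ! j) $ I j))"
    using tens_eq_sum_elem[of "{..<card C}" "\<lambda>i. xs (h i)" k "\<lambda>_. 1"] by (simp add: xs_def)
  also have "\<dots> = tens k (\<lambda>I. \<Sum>a\<in>C. w a * (\<Prod>j<k. co (x a j) $ I j))"
  proof (rule tens_cong)
    fix I :: "nat \<Rightarrow> 'i"
    show "(\<Sum>i<card C. (\<Prod>j<k. co (xs (h i) ! j) $ I j)) = (\<Sum>a\<in>C. w a * (\<Prod>j<k. co (x a j) $ I j))"
      using sum.reindex_bij_betw[OF h, of "\<lambda>a. (\<Prod>j<k. co (xs a ! j) $ I j)"]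
      by (simp add: co atLeast0LessThan)
  qed
  finally have eq: "tens k (\<lambda>I. \<Sum>a\<in>C. w a * (\<Prod>j<k. co (x a j) $ I j)) =
      (\<lambda>\<phi>s. \<Sum>i<card C. elem_tensor s (xs (h i)) \<phi>s)" ..
  show thesis
  proof (rule that[OF _ eq])
    show "(\<Sum>i<card C. \<Prod>j<k. N (xs (h i) ! j)) = (\<Sum>a\<in>C. norm (w a) * (\<Prod>j<k. N (x a j)))"
      using sum.reindex_bij_betw[OF h, of "\<lambda>a. (\<Prod>j<k. N (xs a ! j))"]
      by (simp add: N atLeast0LessThan)
  qed (simp add: xs_def)
qed

lemma projective_norm_le:
  assumes "finite C" "1 \<le> k"
  shows "projective_norm s N k (tens k (\<lambda>I. \<Sum>a\<in>C. w a * (\<Prod>j<k. co (x a j) $ I j)))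
    \<le> (\<Sum>a\<in>C. norm (w a) * (\<Prod>j<k. N (x a j)))"
proof (rule elementary_decomposition[OF assms, where w = w and x = x])
  fix m :: nat and xs
  assume len: "\<And>i. i < m \<Longrightarrow> length (xs i) = k"
    and eq: "tens k (\<lambda>I. \<Sum>a\<in>C. w a * (\<Prod>j<k. co (x a j) $ I j)) = (\<lambda>\<phi>s. \<Sum>i<m. elem_tensor s (xs i) \<phi>s)"
    and N: "(\<Sum>i<m. \<Prod>j<k. N (xs i ! j)) = (\<Sum>a\<in>C. norm (w a) * (\<Prod>j<k. N (x a j)))"
  show ?thesis
    unfolding projective_norm_def
  proof (rule cInf_lower)
    show "(\<Sum>a\<in>C. norm (w a) * (\<Prod>j<k. N (x a j))) \<in> {\<Sum>i<m. \<Prod>j<k. N (xs i ! j) |(m::nat) xs.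
        (\<forall>i<m. length (xs i) = k) \<and> tens k (\<lambda>I. \<Sum>a\<in>C. w a * (\<Prod>j<k. co (x a j) $ I j)) =
          (\<lambda>\<phi>s. \<Sum>i<m. elem_tensor s (xs i) \<phi>s)}"
      by (intro CollectI exI[of _ m] exI[of _ xs]) (simp add: len eq N)
  qed (auto intro!: bdd_belowI[of _ 0] sum_nonneg prod_nonneg N_nonneg)
qed

text \<open>The infimum must be over a nonempty set; the expansion in basis tensors supplies one
  representation.\<close>

lemma projective_norm_greatest:
  assumes "1 \<le> k"
    and le: "\<And>(m::nat) xs. (\<And>i. i < m \<Longrightarrow> length (xs i) = k) \<Longrightarrow>
      tens k z = (\<lambda>\<phi>s. \<Sum>i<m. elem_tensor s (xs i) \<phi>s) \<Longrightarrow> q \<le> (\<Sum>i<m. \<Prod>j<k. N (xs i ! j))"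
  shows "q \<le> projective_norm s N k (tens k z)"
  unfolding projective_norm_def
proof (rule cInf_greatest)
  have "(\<Sum>J\<in>tuples k UNIV. z J * (\<Prod>j<k. co (ve (axis (J j) 1)) $ I j)) = z I" if I: "I \<in> tuples k UNIV" for I
  proof -
    have "(\<Sum>J\<in>tuples k UNIV. z J * (\<Prod>j<k. co (ve (axis (J j) 1)) $ I j)) =
        tform k z (\<lambda>j. axis (I j) 1)"
      unfolding tform_def by (intro sum.cong refl) (simp add: axis_sym)
    then show ?thesis
      using I by (simp add: tform_axis)
  qed
  then have z: "tens k (\<lambda>I. \<Sum>J\<in>tuples k UNIV. z J * (\<Prod>j<k. co (ve (axis (J j) 1)) $ I j)) = tens k z"
    by (rule tens_cong)
  obtain m :: nat and xs where "\<And>i. i < m \<Longrightarrow> length (xs i) = k"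
    "tens k z = (\<lambda>\<phi>s. \<Sum>i<m. elem_tensor s (xs i) \<phi>s)"
    by (rule elementary_decomposition[OF _ assms(1), of "tuples k UNIV" z "\<lambda>J j. ve (axis (J j) 1)",
          unfolded z]) auto
  then show "{\<Sum>i<m. \<Prod>j<k. N (xs i ! j) |(m::nat) xs. (\<forall>i<m. length (xs i) = k) \<and>
      tens k z = (\<lambda>\<phi>s. \<Sum>i<m. elem_tensor s (xs i) \<phi>s)} \<noteq> {}"
    by blast
qed (auto intro: le)

lemma projective_norm_nonneg: "1 \<le> k \<Longrightarrow> 0 \<le> projective_norm s N k (tens k z)"
  by (rule projective_norm_greatest) (auto intro!: sum_nonneg prod_nonneg N_nonneg)

text \<open>Duality: pairing with \<open>w\<close> is linear, and on an elementary tensor it is a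
  value of the form with coefficients \<open>w\<close>, hence at most \<open>T\<close> times the
  product of the Euclidean norms, each at most \<open>c' * N\<close>. Summing over any
  representation of \<open>z\<close> gives the bound.\<close>

lemma projective_norm_ge:
  fixes z w :: "(nat \<Rightarrow> 'i) \<Rightarrow> 'k"
  assumes "1 \<le> k" "0 < T"
    and T: "\<And>u. (\<And>j. j < k \<Longrightarrow> norm (u j) \<le> 1) \<Longrightarrow> norm (tform k w u) \<le> T"
  shows "norm (\<Sum>I\<in>tuples k UNIV. w I * z I) / (T * c' ^ k) \<le> projective_norm s N k (tens k z)"
proof (rule projective_norm_greatest[OF assms(1)])
  fix m :: nat and xs
  assume len: "\<And>i. i < m \<Longrightarrow> length (xs i) = k"
    and eq: "tens k z = (\<lambda>\<phi>s. \<Sum>i<m. elem_tensor s (xs i) \<phi>s)"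
  have "tens k z = tens k (\<lambda>I. \<Sum>i<m. (\<Prod>j<k. co (xs i ! j) $ I j))"
    using tens_eq_sum_elem[of "{..<m}" xs k "\<lambda>_. 1"] len by (simp add: eq)
  then have "z I = (\<Sum>i<m. (\<Prod>j<k. co (xs i ! j) $ I j))" if "I \<in> tuples k UNIV" for I
    using that by (rule tens_eqD)
  then have "(\<Sum>I\<in>tuples k UNIV. w I * z I) = (\<Sum>i<m. tform k w (\<lambda>j. co (xs i ! j)))"
    by (simp add: tform_def sum_distrib_left sum.swap[of _ _ "{..<m}"])
  also have "norm \<dots> \<le> (\<Sum>i<m. T * (\<Prod>j<k. norm (co (xs i ! j))))"
    by (intro sum_norm_le norm_tform_le_prod T)
  also have "\<dots> \<le> (\<Sum>i<m. T * (\<Prod>j<k. c' * N (xs i ! j)))"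
    using assms(2) by (intro sum_mono mult_left_mono prod_mono conjI norm_co_le) auto
  also have "\<dots> = T * c' ^ k * (\<Sum>i<m. \<Prod>j<k. N (xs i ! j))"
    by (simp add: prod.distrib sum_distrib_left mult_ac)
  finally show "norm (\<Sum>I\<in>tuples k UNIV. w I * z I) / (T * c' ^ k) \<le> (\<Sum>i<m. \<Prod>j<k. N (xs i ! j))"
    using assms(2) c'_pos by (simp add: field_simps)
qed

lemma projective_norm_frame:
  fixes z :: "(nat \<Rightarrow> 'i) \<Rightarrow> 'k"
  assumes "1 \<le> k"
  shows "(projective_norm s N k (tens k z))\<^sup>2 \<le>
    (CARD('i) / c'\<^sup>2) ^ k * (\<Sum>I\<in>tuples k UNIV. (norm (z I))\<^sup>2)"
proof -
  \<comment> \<open>The frame coefficients of \<open>z\<close>. Synthesis with the same frame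
    multiplies by \<open>\<kappa>' ^ k\<close>, so dividing by it reproduces
    \<open>z\<close>.\<close>
  define w where "w a = tform k z (\<lambda>j. G_vec (a j))" for a
  let ?S = "\<Sum>I\<in>tuples k UNIV. (norm (z I))\<^sup>2"
  have z: "(\<Sum>a\<in>tuples k A. w a / of_real (\<kappa>' ^ k) * (\<Prod>j<k. co (ve (G_vec (a j))) $ I j)) = z I"
    if I: "I \<in> tuples k UNIV" for I
  proof -
    have "(\<Sum>a\<in>tuples k A. w a * (\<Prod>j<k. G_vec (a j) $ I j))
      = (\<Sum>a\<in>tuples k A. \<Sum>J\<in>tuples k UNIV.
          z J * of_real ((\<Prod>j<k. G (a j) (J j)) * (\<Prod>j<k. G (a j) (I j))))"
      unfolding w_def tform_of_real by (simp add: sum_distrib_left mult_ac)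
    also have "\<dots> = (\<Sum>J\<in>tuples k UNIV. z J *
        of_real (\<Sum>a\<in>tuples k A. (\<Prod>j<k. G (a j) (J j)) * (\<Prod>j<k. G (a j) (I j))))"
      unfolding of_real_sum sum_distrib_left by (rule sum.swap)
    also have "\<dots> = (\<Sum>J\<in>tuples k UNIV. if J = I then z J * of_real (\<kappa>' ^ k) else 0)"
      using I by (intro sum.cong refl) (simp add: frame_tuples[OF A(1) G_frame])
    also have "\<dots> = z I * of_real (\<kappa>' ^ k)"
      using I by simp
    finally have "(\<Sum>a\<in>tuples k A. w a * (\<Prod>j<k. G_vec (a j) $ I j)) / of_real (\<kappa>' ^ k) = z I"
      using \<kappa>'_pos by simp
    then show ?thesis
      by (simp add: sum_divide_distrib)
  qed
  have "projective_norm s N k (tens k z) \<le>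
      (\<Sum>a\<in>tuples k A. norm (w a / of_real (\<kappa>' ^ k)) * (\<Prod>j<k. N (ve (G_vec (a j)))))"
    using projective_norm_le[of "tuples k A" k "\<lambda>a. w a / of_real (\<kappa>' ^ k)" "\<lambda>a j. ve (G_vec (a j))"]
      A(1) assms
    by (subst tens_cong[OF z[symmetric]]) auto
  also have "\<dots> \<le> (\<Sum>a\<in>tuples k A. norm (w a / of_real (\<kappa>' ^ k)) * 1)"
    by (intro sum_mono mult_left_mono prod_le_1 conjI N_nonneg G_ball) auto
  also have "\<dots> = (\<Sum>a\<in>tuples k A. norm (w a)) / \<kappa>' ^ k"
    using \<kappa>'_pos by (simp add: norm_divide norm_power sum_divide_distrib)
  finally have le: "projective_norm s N k (tens k z) \<le> (\<Sum>a\<in>tuples k A. norm (w a)) / \<kappa>' ^ k" .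
  have "(projective_norm s N k (tens k z))\<^sup>2 \<le> (\<Sum>a\<in>tuples k A. norm (w a) * 1)\<^sup>2 / (\<kappa>' ^ k)\<^sup>2"
    using power_mono[OF le projective_norm_nonneg[OF assms], of 2] by (simp add: power_divide)
  \<comment> \<open>Cauchy-Schwarz trades the sum of the moduli for the sum of squares that Parseval
    evaluates, at the price of the number of frame tuples.\<close>
  also have "\<dots> \<le> ((\<Sum>a\<in>tuples k A. (norm (w a))\<^sup>2) * (\<Sum>a\<in>tuples k A. 1\<^sup>2)) / (\<kappa>' ^ k)\<^sup>2"
    by (intro divide_right_mono Cauchy_Schwarz_ineq_sum) auto
  also have "\<dots> = (\<kappa>' ^ k * ?S) * card A ^ k / (\<kappa>' ^ k)\<^sup>2"
    unfolding w_def sum_norm_tform_frame[OF A(1) G_frame] by (simp add: card_tuples)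
  also have "\<dots> = (card A / \<kappa>') ^ k * ?S"
    using \<kappa>'_pos by (simp add: field_simps power2_eq_square)
  also have "card A / \<kappa>' = CARD('i) / c'\<^sup>2"
    using \<kappa>'_eq \<kappa>'_pos c'_pos by (simp add: field_simps)
  finally show ?thesis .
qed

lemma tens_eq_0_iff: "tens k z = (\<lambda>_. 0) \<longleftrightarrow> (\<forall>I\<in>tuples k UNIV. z I = 0)"
  using tens_eqD[of k z "\<lambda>_. 0"] tens_cong[of k z "\<lambda>_. 0"] by (auto simp: tens_0)

lemma injective_norm_pos:
  assumes "tens k z \<noteq> (\<lambda>_. 0)"
  shows "0 < injective_norm s N k (tens k z)"
proof -
  obtain I where I: "I \<in> tuples k UNIV" "z I \<noteq> 0"
    using assms unfolding tens_eq_0_iff by auto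
  then have "0 < (norm (z I))\<^sup>2"
    by simp
  also have "\<dots> \<le> (\<Sum>I\<in>tuples k UNIV. (norm (z I))\<^sup>2)"
    using I(1) by (intro member_le_sum) auto
  also note sum_norm_le_injective
  finally have "injective_norm s N k (tens k z) \<noteq> 0"
    by (auto simp: zero_less_mult_iff)
  then show ?thesis
    using injective_norm_nonneg[of k z] by linarith
qed

text \<open>The Euclidean norm is the intermediate quantity; comparing squares avoids roots of the
  dimension.\<close>

lemma projective_le_injective:
  assumes "1 \<le> k"
  shows "projective_norm s N k (tens k z) \<le> (CARD('i) / (c * c')) ^ k * injective_norm s N k (tens k z)"
proof (rule power2_le_imp_le)
  have "(projective_norm s N k (tens k z))\<^sup>2 \<le>
      (CARD('i) / c'\<^sup>2) ^ k * ((CARD('i) / c\<^sup>2) ^ k * (injective_norm s N k (tens k z))\<^sup>2)"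
    by (rule order.trans[OF projective_norm_frame[OF assms] mult_left_mono[OF sum_norm_le_injective]]) simp
  also have "\<dots> = ((CARD('i) / (c * c')) ^ k * injective_norm s N k (tens k z))\<^sup>2"
    by (simp add: power_mult_distrib power_divide power2_eq_square mult_ac)
  finally show "(projective_norm s N k (tens k z))\<^sup>2 \<le>
      ((CARD('i) / (c * c')) ^ k * injective_norm s N k (tens k z))\<^sup>2" .
  show "0 \<le> (CARD('i) / (c * c')) ^ k * injective_norm s N k (tens k z)"
    using c_pos c'_pos injective_norm_nonneg by simp
qed

section \<open>Extremal ratios of the two norms and their limit\<close>

abbreviation norm_ratios :: "nat \<Rightarrow> real set" where
  "norm_ratios k \<equiv> {projective_norm s N k z / injective_norm s N k z | z.
     z \<in> tensor_power s k \<and> z \<noteq> (\<lambda>\<phi>s. 0)}"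

lemma norm_ratios_le:
  assumes "1 \<le> k" "r \<in> norm_ratios k"
  shows "r \<le> (CARD('i) / (c * c')) ^ k"
proof -
  obtain z where "r = projective_norm s N k (tens k z) / injective_norm s N k (tens k z)"
    "tens k z \<noteq> (\<lambda>_. 0)"
    using assms(2) by (auto simp: tensor_power_eq)
  then show ?thesis
    using injective_norm_pos[of k z] projective_le_injective[OF assms(1), of z]
    by (simp add: pos_divide_le_eq)
qed

text \<open>The sign tensor is tested against itself: \<open>z I * z I\<close> is 1 over both
  fields, so the pairing counts the index tuples. The bound \<open>T\<close> is spent twice, on the
  projective norm from below and on the injective norm from above, hence the square.\<close>

lemma norm_ratios_ge:
  assumes "1 \<le> k" "0 < T" and w: "\<And>I. I \<in> tuples k UNIV \<Longrightarrow> \<bar>w I :: real\<bar> = 1"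
    and T: "\<And>u :: nat \<Rightarrow> 'k ^ 'i. (\<And>j. j < k \<Longrightarrow> norm (u j) \<le> 1) \<Longrightarrow>
      norm (tform k (\<lambda>I. of_real (w I)) u) \<le> T"
  obtains r where "r \<in> norm_ratios k" "(CARD('i) / (c * c')) ^ k / T\<^sup>2 \<le> r"
proof -
  define z where "z I = (of_real (w I) :: 'k)" for I
  have "(\<Sum>I\<in>tuples k UNIV. z I * z I) = (\<Sum>I\<in>tuples k (UNIV :: 'i set). 1)"
  proof (intro sum.cong refl)
    fix I :: "nat \<Rightarrow> 'i" assume "I \<in> tuples k UNIV"
    from w[OF this] have "w I = 1 \<or> w I = -1"
      by linarith
    then show "z I * z I = 1"
      by (auto simp: z_def)
  qed
  then have "norm (\<Sum>I\<in>tuples k UNIV. z I * z I) = real CARD('i) ^ k"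
    by (simp add: card_tuples norm_power)
  then have p: "real CARD('i) ^ k / (T * c' ^ k) \<le> projective_norm s N k (tens k z)"
    using projective_norm_ge[OF assms(1,2), of z z] T unfolding z_def by simp
  have i: "injective_norm s N k (tens k z) \<le> T * c ^ k"
    unfolding z_def by (rule injective_norm_le[OF T])
  have "tuples k (UNIV :: 'i set) \<noteq> {}"
    by (simp add: PiE_eq_empty_iff)
  then obtain I :: "nat \<Rightarrow> 'i" where I: "I \<in> tuples k UNIV"
    by (auto simp only: ex_in_conv[symmetric])
  then have "z I \<noteq> 0"
    using w[OF I] by (auto simp: z_def)
  then have nz: "tens k z \<noteq> (\<lambda>_. 0)"
    unfolding tens_eq_0_iff by (intro notI) (drule bspec[OF _ I], simp)
  show thesis
  proof
    show "projective_norm s N k (tens k z) / injective_norm s N k (tens k z) \<in> norm_ratios k"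
      by (intro CollectI exI[of _ "tens k z"] conjI refl nz tens_in_tensor_power)
    have "(CARD('i) / (c * c')) ^ k / T\<^sup>2 = (real CARD('i) ^ k / (T * c' ^ k)) / (T * c ^ k)"
      by (simp add: power_divide power_mult_distrib power2_eq_square mult_ac)
    also have "\<dots> \<le> projective_norm s N k (tens k z) / injective_norm s N k (tens k z)"
      using p i injective_norm_pos[OF nz] assms(2) projective_norm_nonneg[OF assms(1), of z] c'_pos by (intro frac_le) auto
    finally show "(CARD('i) / (c * c')) ^ k / T\<^sup>2 \<le>
        projective_norm s N k (tens k z) / injective_norm s N k (tens k z)" .
  qed
qed

lemma tensor_rho_le:
  assumes "1 \<le> k"
  shows "tensor_rho s N k \<le> CARD('i) / (c * c')"
proof -
  have nn: "0 \<le> CARD('i) / (c * c')"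
    using c_pos c'_pos by simp
  \<comment> \<open>The all-ones tensor shows that the set of ratios is nonempty, as
    \<open>cSup_least\<close> requires.\<close>
  have "tuples k (UNIV :: 'i set) \<noteq> {}"
    by (simp add: PiE_eq_empty_iff)
  then have "tens k (\<lambda>_. 1) \<noteq> (\<lambda>_. 0)"
    by (simp add: tens_eq_0_iff ex_in_conv)
  then have "projective_norm s N k (tens k (\<lambda>_. 1)) / injective_norm s N k (tens k (\<lambda>_. 1)) \<in> norm_ratios k"
    using tens_in_tensor_power by (intro CollectI exI[of _ "tens k (\<lambda>_. 1)"] conjI refl)
  then have "norm_ratios k \<noteq> {}"
    by (rule contrapos_pn) simp
  then have "Sup (norm_ratios k) \<le> (CARD('i) / (c * c')) ^ k"
    using norm_ratios_le[OF assms] by (rule cSup_least)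
  then have "tensor_rho s N k \<le> root k ((CARD('i) / (c * c')) ^ k)"
    unfolding tensor_rho_def using assms by (intro real_root_le_mono) auto
  then show ?thesis
    using assms nn by (simp add: real_root_power_cancel)
qed

theorem tensor_radius: "has_tensor_radius s N (CARD('i) / (c * c'))"
  unfolding has_tensor_radius_def
proof (rule order_tendstoI)
  fix a assume "CARD('i) / (c * c') < a"
  then show "\<forall>\<^sub>F k in sequentially. tensor_rho s N k < a"
    using tensor_rho_le by (intro eventually_sequentiallyI[of 1]) (rule le_less_trans)
next
  let ?D = "CARD('i) / (c * c')"
  have D: "?D > 0"
    using c_pos c'_pos by simp
  fix a assume a: "a < ?D"
  \<comment> \<open>\<delta> is taken so close to 0 that the loss (1 - \<delta>)^2 caused by the net
    still leaves more than \<open>a\<close>.\<close>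
  have "((\<lambda>\<delta>. ?D * (1 - \<delta>)\<^sup>2) \<longlongrightarrow> ?D * (1 - 0)\<^sup>2) (at_right 0)"
    by (intro tendsto_intros)
  then have "\<forall>\<^sub>F \<delta> in at_right 0. a < ?D * (1 - \<delta>)\<^sup>2"
    using a by (auto dest: order_tendstoD)
  moreover have "\<forall>\<^sub>F \<delta> in at_right 0. (\<delta>::real) \<in> {0<..<1}"
    by (rule eventually_at_right_real) simp
  ultimately have "\<forall>\<^sub>F \<delta> in at_right 0. a < ?D * (1 - \<delta>)\<^sup>2 \<and> (\<delta>::real) \<in> {0<..<1}"
    by (rule eventually_conj)
  then obtain \<delta> where \<delta>: "a < ?D * (1 - \<delta>)\<^sup>2" "0 < \<delta>" "\<delta> < 1"
    using eventually_happens[of _ "at_right (0::real)"] by auto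
  obtain C where "0 < C" and C: "\<And>k. 1 \<le> k \<Longrightarrow> \<exists>w :: (nat \<Rightarrow> 'i) \<Rightarrow> real. (\<forall>I\<in>tuples k UNIV. \<bar>w I\<bar> = 1) \<and>
      (\<forall>u :: nat \<Rightarrow> 'k ^ 'i. (\<forall>j<k. norm (u j) \<le> 1) \<longrightarrow>
        norm (tform k (\<lambda>I. of_real (w I)) u) \<le> C * k / (1 - \<delta>) ^ k)"
    using exists_tensor_small_injective[OF \<delta>(2,3)] by auto
  have lower: "?D * (1 - \<delta>)\<^sup>2 / (root k C * root k k)\<^sup>2 \<le> tensor_rho s N k" if k: "1 \<le> k" for k
  proof -
    define T where "T = C * k / (1 - \<delta>) ^ k"
    have "T > 0"
      using \<open>0 < C\<close> k \<delta> by (simp add: T_def)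
    obtain w :: "(nat \<Rightarrow> 'i) \<Rightarrow> real" where w: "\<forall>I\<in>tuples k UNIV. \<bar>w I\<bar> = 1"
      "\<forall>u :: nat \<Rightarrow> 'k ^ 'i. (\<forall>j<k. norm (u j) \<le> 1) \<longrightarrow> norm (tform k (\<lambda>I. of_real (w I)) u) \<le> T"
      using C[OF k] unfolding T_def by (elim exE conjE)
    obtain r where r: "r \<in> norm_ratios k" "?D ^ k / T\<^sup>2 \<le> r"
      by (rule norm_ratios_ge[OF k \<open>0 < T\<close> w(1)[rule_format] w(2)[rule_format]])
    have "r \<le> Sup (norm_ratios k)"
      using norm_ratios_le[OF k] by (intro cSup_upper r(1) bdd_aboveI)
    with r(2) have "?D ^ k / T\<^sup>2 \<le> Sup (norm_ratios k)"
      by (rule order.trans)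
    then have "root k (?D ^ k / T\<^sup>2) \<le> tensor_rho s N k"
      unfolding tensor_rho_def using k by (intro real_root_le_mono) auto
    moreover have "?D ^ k / T\<^sup>2 = (?D * (1 - \<delta>)\<^sup>2) ^ k / (C * k)\<^sup>2"
      by (simp add: T_def power_divide power_mult_distrib power_mult[symmetric] mult.commute[of 2 k])
    moreover have "root k ((?D * (1 - \<delta>)\<^sup>2) ^ k / (C * k)\<^sup>2) = ?D * (1 - \<delta>)\<^sup>2 / (root k C * root k k)\<^sup>2"
    proof -
      have "0 \<le> ?D * (1 - \<delta>)\<^sup>2"
        using D by (intro mult_nonneg_nonneg) auto
      then have "root k ((?D * (1 - \<delta>)\<^sup>2) ^ k) = ?D * (1 - \<delta>)\<^sup>2"
        using k by (intro real_root_power_cancel) auto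
      moreover have "root k ((C * k)\<^sup>2) = (root k C * root k k)\<^sup>2"
        using k real_root_power[of k "C * k" 2] by (simp add: real_root_mult)
      ultimately show ?thesis
        by (simp only: real_root_divide)
    qed
    ultimately show ?thesis
      by simp
  qed
  \<comment> \<open>With \<delta> fixed, the k-th roots of the constant \<open>C\<close> and of
    \<open>k\<close> tend to 1, so only the loss of the net survives.\<close>
  have "(\<lambda>k. ?D * (1 - \<delta>)\<^sup>2 / (root k C * root k k)\<^sup>2) \<longlonglongrightarrow> ?D * (1 - \<delta>)\<^sup>2 / (1 * 1)\<^sup>2"
    using \<open>0 < C\<close> by (intro tendsto_intros LIMSEQ_root LIMSEQ_root_const) auto
  then have "\<forall>\<^sub>F k in sequentially. a < ?D * (1 - \<delta>)\<^sup>2 / (root k C * root k k)\<^sup>2"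
    using \<delta>(1) by (intro order_tendstoD(1)) auto
  moreover have "\<forall>\<^sub>F k in sequentially. 1 \<le> k"
    by (rule eventually_ge_at_top)
  ultimately show "\<forall>\<^sub>F k in sequentially. a < tensor_rho s N k"
    by eventually_elim (use lower in \<open>auto intro: less_le_trans\<close>)
qed

end

section \<open>The norms of \<open>\<ell>\<^sub>p\<close>\<close>

text \<open>The tangent at 1 to the convex function y^r, obtained from Young's inequality for y^r
  and 1 with weights 1/r and 1 - 1/r.\<close>

lemma Bernoulli_powr:
  fixes y r :: real
  assumes "0 \<le> y" "1 \<le> r"
  shows "1 + r * (y - 1) \<le> y powr r"
proof (cases "y = 0")
  case False
  have "(y powr r) powr (1 / r) * 1 powr (1 - 1 / r) \<le> 1 / r * y powr r + (1 - 1 / r) * 1"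
    using assms False by (intro Youngs_inequality_0) auto
  then have "y \<le> 1 / r * y powr r + (1 - 1 / r)"
    using assms by (simp add: powr_powr)
  then have "r * y \<le> r * (1 / r * y powr r + (1 - 1 / r))"
    using assms by (intro mult_left_mono) auto
  then show ?thesis
    using assms by (simp add: algebra_simps)
qed (use assms in simp)

text \<open>Meant for nonnegative families, so that moduli of coordinates and singular values can
  share the inequalities below.\<close>

definition lnorm :: "ereal \<Rightarrow> ('n::finite \<Rightarrow> real) \<Rightarrow> real" where
  "lnorm p a = (if p = \<infinity> then Max (range a)
     else (\<Sum>i\<in>UNIV. a i powr real_of_ereal p) powr (1 / real_of_ereal p))"

lemma lp_norm_eq: "lp_norm p x = lnorm p (\<lambda>i. norm (x $ i))"
  by (simp add: lp_norm_def lnorm_def)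

lemma lnorm_real: "lnorm (ereal q) a = (\<Sum>i\<in>UNIV. a i powr q) powr (1 / q)"
  by (simp add: lnorm_def)

lemma lnorm_infinity: "lnorm \<infinity> a = Max (range a)"
  by (simp add: lnorm_def)

lemma lnorm_2:
  assumes "\<And>i. 0 \<le> a i"
  shows "lnorm 2 a = sqrt (\<Sum>i\<in>UNIV. (a i)\<^sup>2)"
  using assms lnorm_real[of 2 a] by (simp add: powr_half_sqrt sum_nonneg)

lemma lnorm_1:
  assumes "\<And>i. 0 \<le> a i"
  shows "lnorm 1 a = (\<Sum>i\<in>UNIV. a i)"
  using assms lnorm_real[of 1 a] by (simp add: sum_nonneg one_ereal_def[symmetric])

lemma lnorm_nonneg:
  assumes "\<And>i. 0 \<le> a i"
  shows "0 \<le> lnorm p a"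
proof (cases "p = \<infinity>")
  case True
  have "0 \<le> Max (range a)"
    by (rule order.trans[OF assms[of undefined] Max_ge]) auto
  then show ?thesis
    by (simp add: True lnorm_infinity)
qed (simp add: lnorm_def)

lemma elem_le_lnorm:
  assumes "\<And>i. 0 \<le> a i" "1 \<le> p"
  shows "a i \<le> lnorm p a"
proof (cases p)
  case (real q)
  have q: "1 \<le> q" using assms(2) by (simp add: real)
  have "a i = (a i powr q) powr (1 / q)"
    using q assms(1) by (simp add: powr_powr)
  also have "\<dots> \<le> (\<Sum>i\<in>UNIV. a i powr q) powr (1 / q)"
    using q by (intro powr_mono2 member_le_sum) auto
  finally show ?thesis by (simp add: real lnorm_real)
next
  case PInf
  then show ?thesis by (simp add: lnorm_infinity)
qed (use assms in simp)

lemma lnorm_scale: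
  assumes "\<And>i. 0 \<le> a i" "1 \<le> p" "0 \<le> t"
  shows "lnorm p (\<lambda>i. t * a i) = t * lnorm p a"
proof (cases p)
  case (real q)
  have q: "1 \<le> q" using assms(2) by (simp add: real)
  have "(\<Sum>i\<in>UNIV. (t * a i) powr q) = t powr q * (\<Sum>i\<in>UNIV. a i powr q)"
    using assms by (simp add: powr_mult sum_distrib_left)
  then show ?thesis
    using assms q by (simp add: real lnorm_real powr_mult powr_powr sum_nonneg)
next
  case PInf
  have "mono (\<lambda>x. t * x)"
    using assms(3) by (intro monoI mult_left_mono)
  then have "t * Max (range a) = Max ((\<lambda>x. t * x) ` range a)"
    by (intro mono_Max_commute) auto
  then show ?thesis
    by (simp add: PInf lnorm_infinity image_image)
qed (use assms in simp)

lemma lnorm_one: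
  assumes "1 \<le> p"
  shows "lnorm p (\<lambda>_ :: 'n::finite. 1) = CARD('n) powr real_of_ereal (1 / p)"
  using assms by (cases p) (simp_all add: lnorm_real lnorm_infinity one_ereal_def)

lemma lnorm_single:
  assumes "1 \<le> p"
  shows "lnorm p (\<lambda>i. if i = j then 1 else 0) = 1"
proof (cases p)
  case (real q)
  have "(\<Sum>i\<in>UNIV. (if i = j then 1 else 0) powr q) = (\<Sum>i\<in>UNIV. if i = j then 1 else 0)"
    by (intro sum.cong) auto
  then show ?thesis
    by (simp add: real lnorm_real)
next
  case PInf
  have "Max (range (\<lambda>i. if i = j then 1 else 0 :: real)) = 1"
    by (intro Max_eqI) (auto simp: image_iff)
  then show ?thesis by (simp add: PInf lnorm_infinity)
qed (use assms in simp)

text \<open>Every entry is at most S, the norm with the smaller exponent; hence a^q' <= S^(q' - p')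
  a^p', and the sum over all entries is at most S^q'.\<close>

lemma lnorm_antimono:
  assumes a: "\<And>i. 0 \<le> a i" and "1 \<le> p" "p \<le> q"
  shows "lnorm q a \<le> lnorm p a"
proof (cases q)
  case (real q')
  then obtain p' where p: "p = ereal p'" using assms by (cases p) auto
  have 1: "1 \<le> p'" "p' \<le> q'" using assms by (auto simp: real p)
  define S where "S = lnorm p a"
  have aS: "a i \<le> S" for i unfolding S_def by (intro elem_le_lnorm assms)
  show ?thesis
  proof (cases "S = 0")
    case True
    then have "a i = 0" for i using aS[of i] a[of i] by simp
    then show ?thesis using 1 by (simp add: real p lnorm_real)
  next
    case False
    then have S: "S > 0" using lnorm_nonneg[of a p] a by (simp add: S_def less_le)
    have "(\<Sum>i\<in>UNIV. a i powr q') \<le> (\<Sum>i\<in>UNIV. S powr (q' - p') * a i powr p')"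
    proof (intro sum_mono)
      fix i
      have "a i powr q' = a i powr (q' - p') * a i powr p'"
        by (simp add: powr_add[symmetric])
      also have "\<dots> \<le> S powr (q' - p') * a i powr p'"
        using a aS 1 by (intro mult_right_mono powr_mono2) auto
      finally show "a i powr q' \<le> S powr (q' - p') * a i powr p'" .
    qed
    also have "\<dots> = S powr (q' - p') * (\<Sum>i\<in>UNIV. a i powr p')"
      by (simp add: sum_distrib_left)
    also have "(\<Sum>i\<in>UNIV. a i powr p') = S powr p'"
      using 1 by (simp add: S_def p lnorm_real powr_powr sum_nonneg)
    also have "S powr (q' - p') * S powr p' = S powr q'"
      by (simp add: powr_add[symmetric])
    finally have "(\<Sum>i\<in>UNIV. a i powr q') powr (1 / q') \<le> (S powr q') powr (1 / q')"
      using 1 by (intro powr_mono2) (auto simp: sum_nonneg)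
    then show ?thesis
      using S 1 by (simp add: real lnorm_real powr_powr S_def[symmetric])
  qed
next
  case PInf
  then show ?thesis
    using elem_le_lnorm[OF a assms(2)] by (auto simp: lnorm_infinity)
qed (use assms in auto)

text \<open>Power mean inequality. For finite exponents Bernoulli is applied to the powers a^p'
  divided by their mean \<open>m\<close>, which makes the linear terms sum to zero; for
  \<open>q = \<infinity>\<close> each entry is bounded by the maximum.\<close>

lemma lnorm_le_powr:
  fixes a :: "'n::finite \<Rightarrow> real"
  assumes a: "\<And>i. 0 \<le> a i" and "1 \<le> p" "p \<le> q"
  shows "lnorm p a \<le> CARD('n) powr (real_of_ereal (1 / p) - real_of_ereal (1 / q)) * lnorm q a"
proof (cases "p = \<infinity>")
  case True
  then have "q = \<infinity>" using assms by simp
  then show ?thesis by (simp add: True)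
next
  case False
  then obtain p' where p: "p = ereal p'" and p1: "1 \<le> p'" using assms by (cases p) auto
  have ip: "real_of_ereal (1 / p) = 1 / p'" using p1 by (simp add: p one_ereal_def)
  let ?n = "real CARD('n)"
  show ?thesis
  proof (cases q)
    case (real q')
    have "p' \<le> q'" using assms by (simp add: real p)
    then have r: "1 \<le> q' / p'" "1 \<le> q'" using p1 by (auto simp: field_simps)
    have iq: "real_of_ereal (1 / q) = 1 / q'" using r by (simp add: real one_ereal_def)
    define m where "m = (\<Sum>i\<in>UNIV. a i powr p') / ?n"
    have m0: "0 \<le> m" by (simp add: m_def sum_nonneg)
    have "?n * m powr (q' / p') \<le> (\<Sum>i\<in>UNIV. a i powr q')"
    proof (cases "m = 0")
      case True
      then show ?thesis by (simp add: sum_nonneg)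
    next
      case False
      have "?n = (\<Sum>i\<in>(UNIV :: 'n set). 1 + q' / p' * (a i powr p' / m - 1))"
        using False by (simp add: sum.distrib sum_subtractf flip: sum_distrib_left sum_divide_distrib)
          (simp add: m_def)
      also have "\<dots> \<le> (\<Sum>i\<in>UNIV. (a i powr p' / m) powr (q' / p'))"
        using r m0 by (intro sum_mono Bernoulli_powr) auto
      also have "\<dots> = (\<Sum>i\<in>UNIV. a i powr q') / m powr (q' / p')"
        using m0 p1 by (simp add: powr_divide powr_powr sum_divide_distrib)
      finally show ?thesis
        using False m0 by (simp add: field_simps)
    qed
    then have "(?n * m powr (q' / p')) powr (1 / q') \<le> (\<Sum>i\<in>UNIV. a i powr q') powr (1 / q')"
      using r by (intro powr_mono2) auto
    then have "?n powr (1 / q') * m powr (1 / p') \<le> lnorm q a"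
      using r p1 by (simp add: powr_mult powr_powr real lnorm_real)
    then have "?n powr (1 / p' - 1 / q') * (?n powr (1 / q') * m powr (1 / p')) \<le> ?n powr (1 / p' - 1 / q') * lnorm q a"
      by (intro mult_left_mono) auto
    moreover have "?n powr (1 / p' - 1 / q') * (?n powr (1 / q') * m powr (1 / p')) = (?n * m) powr (1 / p')"
      using m0 by (simp add: powr_mult mult.assoc[symmetric] powr_add[symmetric])
    moreover have "\<dots> = lnorm p a"
      by (simp add: m_def p lnorm_real)
    ultimately show ?thesis
      by (simp add: ip iq)
  next
    case PInf
    have "a i \<le> Max (range a)" for i by simp
    then have "(\<Sum>i\<in>UNIV. a i powr p') \<le> (\<Sum>i\<in>(UNIV :: 'n set). Max (range a) powr p')"
      using a p1 by (intro sum_mono powr_mono2) auto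
    then have "lnorm p a \<le> (?n * Max (range a) powr p') powr (1 / p')"
      unfolding p lnorm_real using p1 by (intro powr_mono2) (auto simp: sum_nonneg)
    also have "\<dots> = ?n powr (1 / p') * Max (range a)"
      using p1 lnorm_nonneg[of a \<infinity>] a by (simp add: powr_mult powr_powr lnorm_infinity)
    finally show ?thesis
      unfolding ip by (simp add: PInf lnorm_infinity)
  qed (use assms in auto)
qed

section \<open>Sign vectors and the setting shared by both families\<close>

definition signs :: "('n::finite \<Rightarrow> real) set" where
  "signs = Pi\<^sub>E UNIV (\<lambda>_. {1, -1})"

lemma finite_signs: "finite signs" and signs_nonempty: "signs \<noteq> {}"
  by (simp_all add: signs_def finite_PiE PiE_eq_empty_iff)

lemma abs_signs: "\<sigma> \<in> signs \<Longrightarrow> \<bar>\<sigma> i\<bar> = 1" and square_signs: "\<sigma> \<in> signs \<Longrightarrow> \<sigma> i * \<sigma> i = 1"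
  using PiE_mem[of \<sigma> UNIV "\<lambda>_. {1, -1}" i] by (auto simp: signs_def)

text \<open>For \<open>i \<noteq> j\<close>, flipping the sign at \<open>i\<close> permutes the sign
  vectors and negates the product, so the sum equals its own negative.\<close>

lemma sum_signs:
  fixes i j :: "'n::finite"
  shows "(\<Sum>\<sigma>\<in>signs. \<sigma> i * \<sigma> j) = (if i = j then card (signs :: ('n \<Rightarrow> real) set) else 0)"
proof (cases "i = j")
  case True
  then show ?thesis by (simp add: square_signs)
next
  case False
  define flip where "flip \<sigma> = \<sigma>(i := - \<sigma> i)" for \<sigma> :: "'n \<Rightarrow> real"
  have flip: "flip \<sigma> \<in> signs" if "\<sigma> \<in> signs" for \<sigma>
    using that by (force simp: signs_def flip_def PiE_iff extensional_def)
  have "(\<Sum>\<sigma>\<in>signs. \<sigma> i * \<sigma> j) = (\<Sum>\<sigma>\<in>signs. flip \<sigma> i * flip \<sigma> j)"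
    by (rule sum.reindex_bij_witness[of _ flip flip]) (simp_all add: flip, simp_all add: flip_def)
  also have "\<dots> = - (\<Sum>\<sigma>\<in>signs. \<sigma> i * \<sigma> j)"
    using False by (simp add: flip_def sum_negf)
  finally show ?thesis
    using False by simp
qed

text \<open>\<open>v x\<close> stands for the moduli of the coordinates or for the singular values,
  \<open>H\<close> for the sign vectors or the signed permutation matrices. Bounds on functionals
  are asked for at the exponents 1 and \<infinity> only; the comparisons between exponents carry
  them over to \<open>p\<close>.\<close>

locale lnorm_space = coordinates s co
  for s :: "'k::scalar_field \<Rightarrow> 'v::ab_group_add \<Rightarrow> 'v" and co :: "'v \<Rightarrow> 'k ^ 'i::finite" +
  fixes p :: ereal and N :: "'v \<Rightarrow> real" and v :: "'v \<Rightarrow> 'm::finite \<Rightarrow> real"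
    and C :: "'c set" and H :: "'c \<Rightarrow> 'i \<Rightarrow> real" and r :: real
  assumes p: "1 \<le> p" and N_eq: "N x = lnorm p (v x)" and v_nonneg: "0 \<le> v x m"
    and N_scale: "N (s t x) = norm t * N x" and norm_co: "norm (co x) = lnorm 2 (v x)"
    and C: "finite C" "C \<noteq> {}"
    and H_frame: "(\<Sum>a\<in>C. H a i * H a j) = (if i = j then r else 0)"
    and H_norm: "a \<in> C \<Longrightarrow> (\<Sum>i\<in>UNIV. (H a i)\<^sup>2) = CARD('m)"
    and H_N: "a \<in> C \<Longrightarrow> N (ve (\<chi> i. of_real (H a i))) \<le> CARD('m) powr real_of_ereal (1 / p)"
    and H_dual: "a \<in> C \<Longrightarrow> norm (fun_of (\<chi> i. of_real (H a i)) x) \<le> lnorm 1 (v x)"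
    and axis_N: "N (ve (axis i 1)) \<le> 1"
    and axis_dual: "norm (co x $ i) \<le> lnorm \<infinity> (v x)"
begin

lemma N_nonneg: "0 \<le> N x"
  by (simp add: N_eq lnorm_nonneg v_nonneg)

lemma fun_of_scale:
  "fun_of (\<chi> i. of_real (t * H a i)) x = of_real t * fun_of (\<chi> i. of_real (H a i)) x"
  by (simp add: fun_of_def sum_distrib_left mult_ac)

lemma ve_scale: "ve (\<chi> i. of_real (t * H a i)) = s (of_real t) (ve (\<chi> i. of_real (H a i)))"
proof -
  have "co (ve (\<chi> i. of_real (t * H a i))) = co (s (of_real t) (ve (\<chi> i. of_real (H a i))))"
    by (simp add: co.scale vec_eq_iff)
  then show ?thesis
    by (simp only: co_inject)
qed

lemma vec_single: "(\<chi> i. of_real (if a = i then 1 else 0)) = (axis a 1 :: 'k ^ 'i)"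
  by (simp add: vec_eq_iff axis_def)

lemma fun_of_axis: "fun_of (axis a 1) x = co x $ a"
  by (simp add: fun_of_def axis_def if_distrib[of "\<lambda>y. _ * y"] cong: if_cong)

lemma sum_single: "(\<Sum>a\<in>UNIV. (if a = i then 1 else 0) * (if a = j then 1 else 0)) = (if i = j then 1 else 0 :: real)"
  for i j :: "'j::finite"
  by (simp add: if_distrib[of "\<lambda>y. _ * y"] cong: if_cong)

lemma frame_scale:
  "(\<Sum>a\<in>C. (t * H a i) * (t * H a j)) = (if i = j then t\<^sup>2 * r else 0)"
proof -
  have "(\<Sum>a\<in>C. (t * H a i) * (t * H a j)) = t\<^sup>2 * (\<Sum>a\<in>C. H a i * H a j)"
    by (simp add: sum_distrib_left power2_eq_square mult_ac)
  then show ?thesis by (simp add: H_frame)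
qed

lemma norm_scale: "a \<in> C \<Longrightarrow> (\<Sum>i\<in>UNIV. (t * H a i)\<^sup>2) = t\<^sup>2 * CARD('m)"
  by (simp add: power_mult_distrib H_norm flip: sum_distrib_left)

theorem tensor_radius:
  "has_tensor_radius s N (CARD('i) / CARD('m) powr \<bar>1 / 2 - real_of_ereal (1 / p)\<bar>)"
proof (cases "p \<le> 2")
  case True
  define q where "q = real_of_ereal (1 / p)"
  let ?n = "real CARD('m)"
  \<comment> \<open>By \<open>H_dual\<close> and the comparison of the exponents 1 and
    \<open>p\<close>, \<open>H\<close> has dual norm at most n^(1 - q); the factor \<open>t\<close>
    scales it into the dual ball.\<close>
  define t where "t = ?n powr (q - 1)"
  have q2: "real_of_ereal (1 / ereal 2) = 1 / 2" "real_of_ereal (1 / 1) = 1"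
    by (simp_all add: numeral_eq_ereal one_ereal_def)
  have q: "1 / 2 \<le> q"
    using p True by (cases p) (auto simp: q_def one_ereal_def numeral_eq_ereal field_simps)
  \<comment> \<open>Extremality: the scaled \<open>H\<close> has Euclidean norm exactly n^(q - 1/2),
    the constant \<open>c\<close> of this case.\<close>
  have t2: "t\<^sup>2 * ?n = (?n powr (q - 1 / 2))\<^sup>2"
  proof -
    have "t\<^sup>2 * ?n powr 1 = ?n powr (2 * (q - 1 / 2))"
      unfolding t_def power2_eq_square powr_add[symmetric] by (simp add: algebra_simps)
    then show ?thesis
      by (simp add: power2_eq_square flip: powr_add)
  qed
  interpret framed_norm s co N "?n powr (q - 1 / 2)" 1 "t\<^sup>2 * r" 1 UNIV
    "\<lambda>a i. if a = i then 1 else 0" C "\<lambda>a i. t * H a i"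
  proof
    show "norm (co x) \<le> 1 * N x" for x
      using lnorm_antimono[of "v x" p 2] p True by (simp add: norm_co N_eq v_nonneg)
    show "N x \<le> ?n powr (q - 1 / 2) * norm (co x)" for x
      using lnorm_le_powr[of "v x" p 2] p True by (simp add: norm_co N_eq v_nonneg q_def q2)
    show "norm (fun_of (\<chi> i. of_real (t * H b i)) x) \<le> N x" if "b \<in> C" for b x
    proof -
      have "norm (fun_of (\<chi> i. of_real (t * H b i)) x) \<le> t * lnorm 1 (v x)"
        using H_dual[OF that] by (simp add: fun_of_scale norm_mult t_def mult_left_mono del: of_real_mult)
      also have "\<dots> \<le> t * (?n powr (1 - q) * lnorm p (v x))"
        using lnorm_le_powr[of "v x" 1 p] p
        by (intro mult_left_mono) (auto simp: v_nonneg q_def q2 t_def)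
      also have "\<dots> = N x"
        by (simp add: t_def N_eq mult.assoc[symmetric] flip: powr_add)
      finally show ?thesis .
    qed
    show "(\<Sum>i\<in>UNIV. (t * H b i)\<^sup>2) = (?n powr (q - 1 / 2))\<^sup>2" if "b \<in> C" for b
      using norm_scale[OF that, of t] t2 by simp
    show "(\<Sum>i\<in>UNIV. (if a = i then 1 else 0)\<^sup>2) = (1::real)\<^sup>2" for a :: 'i
      by (simp add: if_distrib[of "\<lambda>y. y\<^sup>2"] cong: if_cong)
    show "(\<Sum>a\<in>UNIV. (if a = i then 1 else 0) * (if a = j then 1 else 0)) = (if i = j then 1 else (0::real))" for i j :: 'i
      by (rule sum_single)
    show "N (ve (\<chi> i. of_real (if a = i then 1 else 0))) \<le> 1" for a
      by (simp only: vec_single axis_N)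
    show "(\<Sum>b\<in>C. t * H b i * (t * H b j)) = (if i = j then t\<^sup>2 * r else 0)" for i j
      by (rule frame_scale)
  qed (simp_all add: N_nonneg N_scale C)
  show ?thesis
    using tensor_radius q abs_of_nonpos[of "1 / 2 - q"] by (simp add: q_def[symmetric])
next
  case False
  define q where "q = real_of_ereal (1 / p)"
  let ?n = "real CARD('m)"
  \<comment> \<open>Here the frames change sides: by \<open>H_N\<close> the norm of \<open>H\<close>
    in X is at most n^q, so \<open>t\<close> scales it into the unit ball, while the coordinate
    functionals form the dual frame.\<close>
  define t where "t = ?n powr (- q)"
  have q2: "real_of_ereal (1 / ereal 2) = 1 / 2"
    by (simp add: numeral_eq_ereal one_ereal_def)
  have q: "q \<le> 1 / 2"
    using p False by (cases p) (auto simp: q_def one_ereal_def numeral_eq_ereal field_simps)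
  have t2: "t\<^sup>2 * ?n = (?n powr (1 / 2 - q))\<^sup>2"
  proof -
    have "t\<^sup>2 * ?n powr 1 = ?n powr (2 * (1 / 2 - q))"
      unfolding t_def power2_eq_square powr_add[symmetric] by (simp add: algebra_simps)
    then show ?thesis
      by (simp add: power2_eq_square flip: powr_add)
  qed
  have 2: "2 \<le> p" using False by simp
  interpret framed_norm s co N 1 "?n powr (1 / 2 - q)" 1 "t\<^sup>2 * r"
    C "\<lambda>a i. t * H a i" UNIV "\<lambda>a i. if a = i then 1 else 0"
  proof
    show "N x \<le> 1 * norm (co x)" for x
      using lnorm_antimono[of "v x" 2 p] 2 by (simp add: norm_co N_eq v_nonneg)
    show "norm (co x) \<le> ?n powr (1 / 2 - q) * N x" for x
      using lnorm_le_powr[of "v x" 2 p] 2 by (simp add: norm_co N_eq v_nonneg q_def q2)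
    show "norm (fun_of (\<chi> i. of_real (if b = i then 1 else 0)) x) \<le> N x" for b x
      using axis_dual[of x b] lnorm_antimono[of "v x" p \<infinity>] p
      by (simp only: vec_single fun_of_axis N_eq) (simp add: v_nonneg)
    show "N (ve (\<chi> i. of_real (t * H a i))) \<le> 1" if "a \<in> C" for a
    proof -
      have "N (ve (\<chi> i. of_real (t * H a i))) \<le> t * ?n powr q"
        using H_N[OF that] by (simp add: ve_scale N_scale t_def q_def mult_left_mono del: of_real_mult)
      then show ?thesis
        by (simp add: t_def flip: powr_add)
    qed
    show "(\<Sum>i\<in>UNIV. (t * H b i)\<^sup>2) = (?n powr (1 / 2 - q))\<^sup>2" if "b \<in> C" for b
      using norm_scale[OF that, of t] t2 by simp
    show "(\<Sum>i\<in>UNIV. (if a = i then 1 else 0)\<^sup>2) = (1::real)\<^sup>2" for a :: 'i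
      by (simp add: if_distrib[of "\<lambda>y. y\<^sup>2"] cong: if_cong)
    show "(\<Sum>a\<in>UNIV. (if a = i then 1 else 0) * (if a = j then 1 else 0)) = (if i = j then 1 else (0::real))" for i j :: 'i
      by (rule sum_single)
    show "(\<Sum>b\<in>C. t * H b i * (t * H b j)) = (if i = j then t\<^sup>2 * r else 0)" for i j
      by (rule frame_scale)
  qed (simp_all add: N_nonneg N_scale C)
  show ?thesis
    using tensor_radius q abs_of_nonneg[of "1 / 2 - q"] by (simp add: q_def[symmetric])
qed

end

theorem lp_tensor_radius:
  assumes "1 \<le> p"
  shows "has_tensor_radius vec_scale (lp_norm p :: 'k::scalar_field ^ 'n::finite \<Rightarrow> real)
    (CARD('n) powr (1 - \<bar>1 / 2 - real_of_ereal (1 / p)\<bar>))"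
proof -
  interpret coordinates "vec_scale :: 'k \<Rightarrow> 'k ^ 'n \<Rightarrow> 'k ^ 'n" "\<lambda>x. x"
    by unfold_locales (auto simp: bij_def vec_scale_def vector_add_ldistrib vector_sadd_rdistrib vector_smult_assoc)
  have ve: "ve = (\<lambda>x. x)"
    by (auto simp: fun_eq_iff ve_def inv_def)
  interpret lnorm_space "vec_scale :: 'k \<Rightarrow> 'k ^ 'n \<Rightarrow> 'k ^ 'n" "\<lambda>x. x" p "lp_norm p"
    "\<lambda>x i. norm (x $ i)" signs "\<lambda>\<sigma>. \<sigma>" "card (signs :: ('n \<Rightarrow> real) set)"
  proof
    show "lp_norm p (vec_scale t x) = norm t * lp_norm p x" for t and x :: "'k ^ 'n"
      using assms by (simp add: lp_norm_eq vec_scale_def norm_mult lnorm_scale)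
    show "norm x = lnorm 2 (\<lambda>i. norm (x $ i))" for x :: "'k ^ 'n"
      by (subst lnorm_2) (simp_all add: norm_vec_def L2_set_def)
    show "(\<Sum>\<sigma>\<in>signs. \<sigma> i * \<sigma> j) = (if i = j then real (card (signs :: ('n \<Rightarrow> real) set)) else 0)" for i j :: 'n
      by (simp add: sum_signs)
    show "(\<Sum>i\<in>UNIV. (\<sigma> i)\<^sup>2) = CARD('n)" if "\<sigma> \<in> signs" for \<sigma> :: "'n \<Rightarrow> real"
      using that by (simp add: power2_eq_square square_signs)
    show "lp_norm p (ve (\<chi> i. of_real (\<sigma> i))) \<le> CARD('n) powr real_of_ereal (1 / p)"
      if "\<sigma> \<in> signs" for \<sigma> :: "'n \<Rightarrow> real"
      using that lnorm_one[OF assms, where 'n = 'n] by (simp add: ve lp_norm_eq abs_signs)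
    show "norm (fun_of (\<chi> i. of_real (\<sigma> i)) x) \<le> lnorm 1 (\<lambda>i. norm (x $ i))"
      if "\<sigma> \<in> signs" for \<sigma> :: "'n \<Rightarrow> real" and x :: "'k ^ 'n"
      unfolding fun_of_def lnorm_1[OF norm_ge_zero]
      using that by (intro sum_norm_le) (simp add: norm_mult abs_signs)
    show "lp_norm p (ve (axis i 1)) \<le> 1" for i
      using lnorm_single[OF assms, of i]
      by (simp add: ve lp_norm_eq axis_def if_distrib[of norm] cong: if_cong)
    show "norm (x $ i) \<le> lnorm \<infinity> (\<lambda>i. norm (x $ i))" for x :: "'k ^ 'n" and i
      by (rule elem_le_lnorm) auto
  qed (use assms in \<open>simp_all add: lp_norm_eq finite_signs signs_nonempty\<close>)
  show ?thesis
    using tensor_radius by (simp add: powr_diff)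
qed

section \<open>Singular values\<close>

definition cdot :: "'k::scalar_field ^ 'n::finite \<Rightarrow> 'k ^ 'n \<Rightarrow> 'k" where
  "cdot x y = (\<Sum>i\<in>UNIV. x $ i * conjugate (y $ i))"

lemma cdot_self: "cdot x x = of_real ((norm x)\<^sup>2)"
  by (simp add: cdot_def mult_conjugate_eq_norm norm_vec_def L2_set_def sum_nonneg
      flip: of_real_sum of_real_power)

lemma cdot_commute: "conjugate (cdot x y) = cdot y x"
  by (simp add: cdot_def sum_conjugate conjugate_dist_mul mult.commute)

lemma cdot_add_left: "cdot (x + y) z = cdot x z + cdot y z"
  by (simp add: cdot_def distrib_right sum.distrib)

lemma cdot_scale_left: "cdot (c *s x) y = c * cdot x y"
  by (simp add: cdot_def sum_distrib_left mult.assoc)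

lemma cdot_add_right: "cdot x (y + z) = cdot x y + cdot x z"
  by (simp add: cdot_def distrib_left sum.distrib conjugate_dist_add)

lemma cdot_scale_right: "cdot x (c *s y) = conjugate c * cdot x y"
  by (simp add: cdot_def sum_distrib_left conjugate_dist_mul mult_ac)

lemma cdot_eq_0_commute: "cdot x y = 0 \<longleftrightarrow> cdot y x = 0"
  by (metis cdot_commute conjugate_zero_iff)

lemma norm_cdot_le: "norm (cdot x y) \<le> norm x * norm y"
proof -
  have "norm (cdot x y) \<le> (\<Sum>i\<in>UNIV. norm (x $ i) * norm (y $ i))"
    unfolding cdot_def by (intro sum_norm_le) (simp add: norm_mult)
  also have "\<dots> \<le> norm x * norm y"
    unfolding norm_vec_def using L2_set_mult_ineq[of "\<lambda>i. norm (x $ i)" "\<lambda>i. norm (y $ i)" UNIV] by simp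
  finally show ?thesis .
qed

text \<open>The phase of \<open>t\<close> makes both cross terms real and equal, so a positive
  \<open>e\<close> yields a definite gain of first order.\<close>

lemma norm_sq_add_scale:
  "(norm (x + t *s y))\<^sup>2 = (norm x)\<^sup>2 + 2 * e * (norm (cdot y x))\<^sup>2 + (norm t)\<^sup>2 * (norm y)\<^sup>2"
  if "t = of_real e * conjugate (cdot y x)" for x y :: "'k::scalar_field ^ 'n::finite"
proof -
  have t: "t * cdot y x = of_real (e * (norm (cdot y x))\<^sup>2)"
    using mult_conjugate_eq_norm[of "cdot y x"] by (simp add: that mult_ac)
  then have t': "conjugate t * cdot x y = of_real (e * (norm (cdot y x))\<^sup>2)"
    by (metis cdot_commute conjugate_dist_mul conjugate_of_real)
  have "of_real ((norm (x + t *s y))\<^sup>2) =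
      cdot x x + conjugate t * cdot x y + (t * cdot y x + (t * conjugate t) * cdot y y)"
    unfolding cdot_self[symmetric]
    by (simp add: cdot_add_left cdot_add_right cdot_scale_left cdot_scale_right algebra_simps)
  also have "\<dots> = of_real ((norm x)\<^sup>2 + 2 * e * (norm (cdot y x))\<^sup>2 + (norm t)\<^sup>2 * (norm y)\<^sup>2)"
    unfolding t t' cdot_self mult_conjugate_eq_norm by simp
  finally show ?thesis
    by (simp only: of_real_eq_iff)
qed

lemma norm_sq_add_orthogonal:
  fixes x y :: "'k::scalar_field ^ 'n::finite"
  assumes "cdot y x = 0"
  shows "(norm (x + t *s y))\<^sup>2 = (norm x)\<^sup>2 + (norm t)\<^sup>2 * (norm y)\<^sup>2"
proof -
  have "of_real ((norm (x + t *s y))\<^sup>2) = cdot x x + (t * conjugate t) * cdot y y"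
    using assms cdot_eq_0_commute[of x y] unfolding cdot_self[symmetric]
    by (simp add: cdot_add_left cdot_add_right cdot_scale_left cdot_scale_right algebra_simps)
  also have "\<dots> = of_real ((norm x)\<^sup>2 + (norm t)\<^sup>2 * (norm y)\<^sup>2)"
    unfolding cdot_self mult_conjugate_eq_norm by simp
  finally show ?thesis
    by (simp only: of_real_eq_iff)
qed

lemma norm_vector_scale: "norm (c *s x) = norm c * norm x"
  for x :: "'k::scalar_field ^ 'n::finite"
  by (simp add: norm_vec_def norm_mult L2_set_right_distrib)

lemma matrix_vector_scale: "A *v (c *s x) = c *s (A *v x)"
  for A :: "'k::scalar_field ^ 'n::finite ^ 'm::finite"
  by (simp add: vec_eq_iff matrix_vector_mult_def sum_distrib_left mult_ac)

text \<open>The square matrix with the conjugates of \<open>f i\<close> as rows for \<open>i\<close>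
  in \<open>S\<close> and zero rows elsewhere has a zero row at \<open>k\<close>. It has no right
  inverse, hence no left inverse, hence a kernel vector, which is orthogonal to every
  \<open>f j\<close> with \<open>j\<close> in \<open>S\<close>.\<close>

lemma exists_orthogonal:
  fixes f :: "'n::finite \<Rightarrow> 'k::scalar_field ^ 'n"
  assumes "k \<notin> S"
  obtains w where "norm w = 1" "\<And>j. j \<in> S \<Longrightarrow> cdot w (f j) = 0"
proof -
  define M where "M = (\<chi> i. if i \<in> S then (\<chi> j. conjugate (f i $ j)) else 0)"
  have "(M ** B) $ k $ k \<noteq> mat 1 $ k $ k" for B
    using assms by (simp add: M_def matrix_matrix_mult_def mat_def)
  then have "\<nexists>B. M ** B = mat 1"
    by metis
  then have "\<nexists>B. B ** M = mat 1"
    using matrix_left_right_inverse by blast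
  then obtain x where x: "M *v x = 0" "x \<noteq> 0"
    unfolding matrix_left_invertible_ker by blast
  define w where "w = of_real (1 / norm x) *s x"
  show thesis
  proof
    show "norm w = 1"
      using x(2) by (simp add: w_def norm_vector_scale norm_divide)
    fix j assume "j \<in> S"
    then have "(M *v x) $ j = cdot x (f j)"
      by (simp add: M_def matrix_vector_mult_def cdot_def mult.commute)
    then show "cdot w (f j) = 0"
      using x(1) by (simp add: w_def cdot_scale_left)
  qed
qed

text \<open>A maximiser \<open>g\<close> of \<open>norm (A w)\<close> over the unit vectors orthogonal to the previously chosen
  ones splits off: \<open>A g\<close> is orthogonal to the image of the remaining orthogonal complement.\<close>

lemma exists_singular_basis_on:
  fixes A :: "'k::scalar_field ^ 'n::finite ^ 'm::finite"
  shows "\<exists>f :: 'n \<Rightarrow> 'k ^ 'n. (\<forall>i\<in>S. norm (f i) = 1) \<and>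
    (\<forall>i\<in>S. \<forall>j\<in>S. i \<noteq> j \<longrightarrow> cdot (f i) (f j) = 0 \<and> cdot (A *v f i) (A *v f j) = 0) \<and>
    (\<forall>w. (\<forall>j\<in>S. cdot w (f j) = 0) \<longrightarrow> (\<forall>i\<in>S. cdot (A *v w) (A *v f i) = 0))"
  using finite[of S]
proof (induction S rule: finite_induct)
  case (insert k S)
  from insert.IH obtain f :: "'n \<Rightarrow> 'k ^ 'n" where IH: "\<forall>i\<in>S. norm (f i) = 1"
    "\<forall>i\<in>S. \<forall>j\<in>S. i \<noteq> j \<longrightarrow> cdot (f i) (f j) = 0 \<and> cdot (A *v f i) (A *v f j) = 0"
    "\<forall>w. (\<forall>j\<in>S. cdot w (f j) = 0) \<longrightarrow> (\<forall>i\<in>S. cdot (A *v w) (A *v f i) = 0)"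
    by (elim exE conjE)
  note f = IH(1)[rule_format] IH(2)[rule_format, THEN conjunct1] IH(2)[rule_format, THEN conjunct2]
    IH(3)[rule_format]
  define K where "K = {w. norm w = 1 \<and> (\<forall>j\<in>S. cdot w (f j) = 0)}"
  have cont: "continuous_on UNIV (\<lambda>w. cdot w y)" for y :: "'k ^ 'n"
    unfolding cdot_def by (intro continuous_intros)
  have contA: "continuous_on UNIV (\<lambda>w. A *v w)"
    unfolding matrix_vector_mult_def by (intro continuous_intros)
  have "K = {w. norm w = 1} \<inter> (\<Inter>j\<in>S. {w. cdot w (f j) = 0})"
    by (auto simp: K_def)
  then have "closed K"
    by (simp add: closed_Int closed_INT closed_Collect_eq cont continuous_on_norm_id continuous_on_const)
  moreover have "bounded K"
    by (intro boundedI[of _ 1]) (simp add: K_def)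
  ultimately have "compact K"
    by (simp add: compact_eq_bounded_closed)
  moreover have "K \<noteq> {}"
    by (rule exists_orthogonal[OF insert(2), of f]) (auto simp: K_def)
  moreover have "continuous_on K (\<lambda>w. norm (A *v w))"
    by (intro continuous_on_norm continuous_on_subset[OF contA]) auto
  ultimately obtain g where g: "g \<in> K" and max: "\<And>w. w \<in> K \<Longrightarrow> norm (A *v w) \<le> norm (A *v g)"
    using continuous_attains_sup[of K "\<lambda>w. norm (A *v w)"] by blast
  have g1: "norm g = 1" and g0: "\<And>j. j \<in> S \<Longrightarrow> cdot g (f j) = 0"
    using g by (auto simp: K_def)
  define \<mu> where "\<mu> = norm (A *v g)"
  have bound: "norm (A *v w) \<le> \<mu> * norm w" if w: "\<And>j. j \<in> S \<Longrightarrow> cdot w (f j) = 0" for w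
  proof (cases "w = 0")
    case False
    have "of_real (1 / norm w) *s w \<in> K"
      using False w by (simp add: K_def norm_vector_scale norm_divide cdot_scale_left)
    from max[OF this] show ?thesis
      using False by (simp add: matrix_vector_scale norm_vector_scale norm_divide \<mu>_def field_simps)
  qed simp
  have key: "cdot (A *v w) (A *v g) = 0"
    if w: "\<And>j. j \<in> S \<Longrightarrow> cdot w (f j) = 0" and wg: "cdot w g = 0" for w
  proof (rule ccontr)
    define \<beta> where "\<beta> = cdot (A *v w) (A *v g)"
    assume "cdot (A *v w) (A *v g) \<noteq> 0"
    then have \<beta>: "(norm \<beta>)\<^sup>2 > 0" by (simp add: \<beta>_def)
    \<comment> \<open>Variational argument: passing from \<open>g\<close> to
      \<open>g + t *s w\<close> would raise the squared image norm by at least 2 |\<beta>|^2 / Q,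
      whereas maximality of \<open>g\<close> permits at most |\<beta>|^2 / Q. The summand 1 keeps
      \<open>Q\<close> positive.\<close>
    define Q where "Q = \<mu>\<^sup>2 * (norm w)\<^sup>2 + 1"
    have Q: "Q > 0" "\<mu>\<^sup>2 * (norm w)\<^sup>2 \<le> Q" by (simp_all add: Q_def add_nonneg_pos)
    define t where "t = of_real (1 / Q) * conjugate \<beta>"
    have nt: "(norm t)\<^sup>2 = (1 / Q)\<^sup>2 * (norm \<beta>)\<^sup>2"
      by (simp add: t_def norm_mult norm_divide power_mult_distrib power_divide)
    have "norm (A *v (g + t *s w)) \<le> \<mu> * norm (g + t *s w)"
      using g0 w by (intro bound) (simp add: cdot_add_left cdot_scale_left)
    then have "(norm (A *v (g + t *s w)))\<^sup>2 \<le> \<mu>\<^sup>2 * (norm (g + t *s w))\<^sup>2"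
      using power_mono[of _ _ 2] by (fastforce simp: power_mult_distrib)
    moreover have "(norm (g + t *s w))\<^sup>2 = 1 + (norm t)\<^sup>2 * (norm w)\<^sup>2"
      by (simp add: norm_sq_add_orthogonal[OF wg] g1)
    moreover have "A *v (g + t *s w) = A *v g + t *s (A *v w)"
      by (simp add: matrix_vector_right_distrib matrix_vector_scale)
    moreover have "(norm (A *v g + t *s (A *v w)))\<^sup>2 =
        \<mu>\<^sup>2 + 2 * (1 / Q) * (norm \<beta>)\<^sup>2 + (norm t)\<^sup>2 * (norm (A *v w))\<^sup>2"
      unfolding \<mu>_def \<beta>_def by (rule norm_sq_add_scale) (simp add: t_def \<beta>_def)
    ultimately have "\<mu>\<^sup>2 + 2 * (1 / Q) * (norm \<beta>)\<^sup>2 + (norm t)\<^sup>2 * (norm (A *v w))\<^sup>2 \<le>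
        \<mu>\<^sup>2 * (1 + (norm t)\<^sup>2 * (norm w)\<^sup>2)"
      by simp
    moreover have "0 \<le> (norm t)\<^sup>2 * (norm (A *v w))\<^sup>2"
      by simp
    moreover have "\<mu>\<^sup>2 * (1 + (norm t)\<^sup>2 * (norm w)\<^sup>2) = \<mu>\<^sup>2 + (norm t)\<^sup>2 * (\<mu>\<^sup>2 * (norm w)\<^sup>2)"
      by (simp add: algebra_simps)
    moreover have "(norm t)\<^sup>2 * (\<mu>\<^sup>2 * (norm w)\<^sup>2) \<le> (norm t)\<^sup>2 * Q"
      by (intro mult_left_mono Q) simp
    moreover have "(norm t)\<^sup>2 * Q = (1 / Q) * (norm \<beta>)\<^sup>2"
      using Q(1) unfolding nt by (simp add: power2_eq_square)
    ultimately have "(1 / Q) * (norm \<beta>)\<^sup>2 \<le> 0"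
      by linarith
    then show False
      using \<beta> Q(1) by (simp add: mult_le_0_iff field_simps)
  qed
  have g0': "cdot (f j) g = 0" if "j \<in> S" for j
    using g0[OF that] cdot_eq_0_commute by blast
  have Ag: "cdot (A *v g) (A *v f j) = 0" "cdot (A *v f j) (A *v g) = 0" if "j \<in> S" for j
    using f(4)[of g j] g0 that cdot_eq_0_commute by blast+
  show ?case
  proof (intro exI[of _ "f(k := g)"] conjI ballI impI allI)
    fix i j assume "i \<in> insert k S" "j \<in> insert k S" "i \<noteq> j"
    then show "cdot ((f(k := g)) i) ((f(k := g)) j) = 0"
      "cdot (A *v (f(k := g)) i) (A *v (f(k := g)) j) = 0"
      using f g0 g0' Ag by auto
  next
    fix i assume "i \<in> insert k S"
    then show "norm ((f(k := g)) i) = 1"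
      using f g1 by auto
  next
    fix w i assume w: "\<forall>j\<in>insert k S. cdot w ((f(k := g)) j) = 0" and i: "i \<in> insert k S"
    have wS: "cdot w (f j) = 0" if "j \<in> S" for j
      using w that insert(2) by (auto split: if_splits)
    have "cdot w g = 0"
      using w by auto
    then show "cdot (A *v w) (A *v (f(k := g)) i) = 0"
      using key[OF wS] f(4)[OF wS] i insert(2) by auto
  qed
qed auto

section \<open>Adjoints, diagonalisation and functional calculus\<close>

lemma adjoint_nth: "adjoint_mat A $ i $ j = conjugate (A $ j $ i)"
  by (simp add: adjoint_mat_def transpose_def map_matrix_def)

lemma adjoint_mult_nth:
  "(adjoint_mat A ** B) $ i $ j = cdot (column j B) (column i A)"
  for A :: "'k::scalar_field ^ 'n::finite ^ 'm::finite"
  by (simp add: matrix_matrix_mult_def adjoint_nth cdot_def column_def mult.commute)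

lemma adjoint_mult: "adjoint_mat (A ** B) = adjoint_mat B ** adjoint_mat A"
  for A :: "'k::scalar_field ^ 'n::finite ^ 'm::finite"
  by (simp add: vec_eq_iff adjoint_nth matrix_matrix_mult_def sum_conjugate conjugate_dist_mul mult.commute)

lemma adjoint_adjoint [simp]: "adjoint_mat (adjoint_mat A) = A"
  by (simp add: vec_eq_iff adjoint_nth)

lemma adjoint_diag [simp]: "adjoint_mat (diag_mat d) = (diag_mat d :: 'k::scalar_field ^ 'n::finite ^ 'n)"
  using conjugate_of_real[of 0, where 'k = 'k] by (auto simp: vec_eq_iff adjoint_nth diag_mat_def)

lemma diag_mult_nth: "(diag_mat d ** A) $ i $ j = of_real (d i) * A $ i $ j"
  for A :: "'k::scalar_field ^ 'n::finite ^ 'm::finite"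
  by (simp add: matrix_matrix_mult_def diag_mat_def if_distrib[of "\<lambda>x. x * _"] cong: if_cong)

lemma mult_diag_nth: "(A ** diag_mat d) $ i $ j = A $ i $ j * of_real (d j)"
  for A :: "'k::scalar_field ^ 'n::finite ^ 'm::finite"
  by (simp add: matrix_matrix_mult_def diag_mat_def if_distrib[of "\<lambda>x. _ * x"] cong: if_cong)

lemma diag_one: "diag_mat (\<lambda>_. 1) = mat 1"
  by (simp add: vec_eq_iff diag_mat_def mat_def)

lemma unitary_mat_one: "unitary_mat (mat 1 :: 'k::scalar_field ^ 'n::finite ^ 'n)"
  by (simp add: unitary_mat_def flip: diag_one) (simp add: diag_one)

text \<open>The singular basis forms the columns of \<open>U\<close>. Its images under
  \<open>A\<close> are orthogonal, so the Gram matrix of \<open>A ** U\<close> is diagonal, and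
  undoing \<open>U\<close> on both sides gives the claim. No characteristic polynomial occurs, so
  real and complex scalars are treated alike.\<close>

lemma exists_unitary_diagonalisation:
  fixes A :: "'k::scalar_field ^ 'n::finite ^ 'm::finite"
  obtains U :: "'k ^ 'n ^ 'n" and d where "unitary_mat U" "\<And>i. 0 \<le> d i"
    "adjoint_mat A ** A = U ** diag_mat (\<lambda>i. (d i)\<^sup>2) ** adjoint_mat U"
proof -
  obtain f :: "'n \<Rightarrow> 'k ^ 'n" where f: "\<And>i. norm (f i) = 1"
    "\<And>i j. i \<noteq> j \<Longrightarrow> cdot (f i) (f j) = 0" "\<And>i j. i \<noteq> j \<Longrightarrow> cdot (A *v f i) (A *v f j) = 0"
    using exists_singular_basis_on[of UNIV A] by auto
  define U where "U = (\<chi> i j. f j $ i)"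
  define d where "d i = norm (A *v f i)" for i
  have col: "column j U = f j" "column j (A ** U) = A *v f j" for j
    by (simp_all add: vec_eq_iff column_def U_def matrix_matrix_mult_def matrix_vector_mult_def)
  have U1: "adjoint_mat U ** U = mat 1"
    by (auto simp: vec_eq_iff adjoint_mult_nth col mat_def cdot_self f)
  then have U2: "U ** adjoint_mat U = mat 1"
    using matrix_left_right_inverse by blast
  have "adjoint_mat (A ** U) ** (A ** U) = diag_mat (\<lambda>i. (d i)\<^sup>2)"
    unfolding vec_eq_iff adjoint_mult_nth col by (auto simp: diag_mat_def cdot_self f d_def)
  then have D: "adjoint_mat U ** (adjoint_mat A ** A) ** U = diag_mat (\<lambda>i. (d i)\<^sup>2)"
    by (simp add: adjoint_mult matrix_mul_assoc)
  have "U ** diag_mat (\<lambda>i. (d i)\<^sup>2) ** adjoint_mat U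
      = (U ** adjoint_mat U) ** (adjoint_mat A ** A) ** (U ** adjoint_mat U)"
    unfolding D[symmetric] by (simp add: matrix_mul_assoc)
  then have "adjoint_mat A ** A = U ** diag_mat (\<lambda>i. (d i)\<^sup>2) ** adjoint_mat U"
    by (simp add: U2 matrix_mul_lid matrix_mul_rid)
  then show thesis
    using that[of U d] U1 U2 by (simp add: unitary_mat_def d_def)
qed

text \<open>The definite description requires independence of the diagonalisation. Two of them are
  linked by \<open>W = adjoint_mat V ** U\<close>, which intertwines the diagonal matrices: an entry
  of \<open>W\<close> is nonzero only where the two eigenvalues agree, and then their powers agree
  too.\<close>

lemma psd_powr_eq:
  fixes U :: "'k::scalar_field ^ 'n::finite ^ 'n"
  assumes U: "unitary_mat U" and d: "\<And>i. 0 \<le> d i"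
    and M: "M = U ** diag_mat d ** adjoint_mat U"
  shows "psd_powr M a = U ** diag_mat (\<lambda>i. d i powr a) ** adjoint_mat U"
  unfolding psd_powr_def
proof (rule the_equality)
  show "\<exists>V e. unitary_mat V \<and> (\<forall>i. 0 \<le> e i) \<and> M = V ** diag_mat e ** adjoint_mat V \<and>
      U ** diag_mat (\<lambda>i. d i powr a) ** adjoint_mat U = V ** diag_mat (\<lambda>i. e i powr a) ** adjoint_mat V"
    using assms by blast
next
  fix B
  assume "\<exists>V e. unitary_mat V \<and> (\<forall>i. 0 \<le> e i) \<and> M = V ** diag_mat e ** adjoint_mat V \<and>
      B = V ** diag_mat (\<lambda>i. e i powr a) ** adjoint_mat V"
  then obtain V e where V: "unitary_mat V" and e: "\<And>i. 0 \<le> e i"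
    and MV: "M = V ** diag_mat e ** adjoint_mat V"
    and B: "B = V ** diag_mat (\<lambda>i. e i powr a) ** adjoint_mat V"
    by auto
  have U1: "adjoint_mat U ** U = mat 1" "U ** adjoint_mat U = mat 1"
    and V1: "adjoint_mat V ** V = mat 1" "V ** adjoint_mat V = mat 1"
    using U V by (auto simp: unitary_mat_def)
  define W where "W = adjoint_mat V ** U"
  have "adjoint_mat V ** M ** U = diag_mat e ** W"
    unfolding MV W_def by (simp add: matrix_mul_assoc V1)
  moreover have "adjoint_mat V ** M ** U = W ** diag_mat d ** (adjoint_mat U ** U)"
    unfolding M W_def by (simp add: matrix_mul_assoc)
  ultimately have eq: "diag_mat e ** W = W ** diag_mat d"
    by (simp add: U1)
  have "diag_mat (\<lambda>i. e i powr a) ** W = W ** diag_mat (\<lambda>i. d i powr a)"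
  proof -
    have "of_real (e i powr a) * W $ i $ j = W $ i $ j * of_real (d j powr a)" for i j
    proof (cases "W $ i $ j = 0")
      case False
      have "(diag_mat e ** W) $ i $ j = (W ** diag_mat d) $ i $ j"
        by (simp add: eq)
      then have "of_real (e i) = (of_real (d j) :: 'k)"
        using False by (simp add: diag_mult_nth mult_diag_nth)
      then show ?thesis
        by simp
    qed simp
    then show ?thesis
      by (simp add: vec_eq_iff diag_mult_nth mult_diag_nth)
  qed
  then have "V ** (diag_mat (\<lambda>i. e i powr a) ** W) ** adjoint_mat U =
      V ** (W ** diag_mat (\<lambda>i. d i powr a)) ** adjoint_mat U"
    by simp
  moreover have "V ** (diag_mat (\<lambda>i. e i powr a) ** W) ** adjoint_mat U = B ** (U ** adjoint_mat U)"
    unfolding B W_def by (simp only: matrix_mul_assoc)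
  moreover have "V ** (W ** diag_mat (\<lambda>i. d i powr a)) ** adjoint_mat U =
      (V ** adjoint_mat V) ** U ** diag_mat (\<lambda>i. d i powr a) ** adjoint_mat U"
    unfolding W_def by (simp only: matrix_mul_assoc)
  ultimately show "B = U ** diag_mat (\<lambda>i. d i powr a) ** adjoint_mat U"
    by (simp add: U1 V1)
qed

text \<open>The columns of \<open>U\<close> are right singular vectors, with the singular values in
  no particular order; the columns of \<open>A ** U\<close> are the left ones multiplied by
  \<sigma>.\<close>

definition singular_decomp ::
    "'k::scalar_field ^ 'n::finite ^ 'n \<Rightarrow> 'k ^ 'n ^ 'n \<Rightarrow> ('n \<Rightarrow> real) \<Rightarrow> bool" where
  "singular_decomp A U \<sigma> \<longleftrightarrow> unitary_mat U \<and> (\<forall>i. 0 \<le> \<sigma> i) \<and>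
    adjoint_mat A ** A = U ** diag_mat (\<lambda>i. (\<sigma> i)\<^sup>2) ** adjoint_mat U"

text \<open>Serves twice: for unitary \<open>V\<close> it gives isometry, for
  \<open>V = A ** U\<close> it expresses image norms by singular values.\<close>

lemma norm_sq_of_gram:
  fixes V :: "'k::scalar_field ^ 'n::finite ^ 'm::finite"
  assumes "adjoint_mat V ** V = diag_mat d"
  shows "(norm (V *v y))\<^sup>2 = (\<Sum>i\<in>UNIV. d i * (norm (y $ i))\<^sup>2)"
proof -
  have eq: "cdot (V *v y) z = cdot y (adjoint_mat V *v z)" for z
  proof -
    have "cdot (V *v y) z = (\<Sum>i\<in>UNIV. \<Sum>j\<in>UNIV. V $ i $ j * y $ j * conjugate (z $ i))"
      by (simp add: cdot_def matrix_vector_mult_def sum_distrib_right)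
    also have "\<dots> = (\<Sum>j\<in>UNIV. \<Sum>i\<in>UNIV. V $ i $ j * y $ j * conjugate (z $ i))"
      by (rule sum.swap)
    also have "\<dots> = cdot y (adjoint_mat V *v z)"
      by (simp add: cdot_def matrix_vector_mult_def adjoint_nth sum_conjugate conjugate_dist_mul
          sum_distrib_left mult_ac)
    finally show ?thesis .
  qed
  have "of_real ((norm (V *v y))\<^sup>2) = cdot y (diag_mat d *v y)"
    by (simp add: cdot_self[symmetric] eq matrix_vector_mul_assoc assms del: of_real_power)
  also have "\<dots> = (\<Sum>i\<in>UNIV. of_real (d i) * (y $ i * conjugate (y $ i)))"
  proof -
    have "(diag_mat d *v y) $ i = of_real (d i) * y $ i" for i
      by (simp add: matrix_vector_mult_def diag_mat_def if_distrib[of "\<lambda>x. x * _"] cong: if_cong)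
    then show ?thesis
      by (simp add: cdot_def conjugate_dist_mul mult_ac)
  qed
  also have "\<dots> = of_real (\<Sum>i\<in>UNIV. d i * (norm (y $ i))\<^sup>2)"
    by (simp add: mult_conjugate_eq_norm)
  finally show ?thesis
    by (simp only: of_real_eq_iff)
qed

lemma norm_unitary_mult:
  assumes "unitary_mat (U :: 'k::scalar_field ^ 'n::finite ^ 'n)"
  shows "norm (U *v y) = norm y"
proof -
  have "(norm (U *v y))\<^sup>2 = (\<Sum>i\<in>UNIV. 1 * (norm (y $ i))\<^sup>2)"
    using assms by (intro norm_sq_of_gram) (simp add: unitary_mat_def diag_one)
  also have "\<dots> = (norm y)\<^sup>2"
    by (simp add: norm_vec_def L2_set_def sum_nonneg)
  finally show ?thesis
    by simp
qed

lemma unitary_adjoint: "unitary_mat U \<Longrightarrow> unitary_mat (adjoint_mat U)"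
  for U :: "'k::scalar_field ^ 'n::finite ^ 'n"
  by (simp add: unitary_mat_def)

lemma matrix_mult_axis: "A *v axis j 1 = column j A"
  for A :: "'k::scalar_field ^ 'n::finite ^ 'm::finite"
  by (simp add: vec_eq_iff matrix_vector_mult_def axis_def column_def
      if_distrib[of "\<lambda>x. _ * x"] cong: if_cong)

lemma column_mult: "column i (A ** B) = A *v column i B"
  for A :: "'k::scalar_field ^ 'n::finite ^ 'm::finite"
  by (simp add: vec_eq_iff column_def matrix_matrix_mult_def matrix_vector_mult_def)

lemma norm_axis_one: "norm (axis j 1 :: 'k::scalar_field ^ 'n::finite) = 1"
  by (simp add: norm_vec_def L2_set_def axis_def if_distrib[of "\<lambda>x. (norm x)\<^sup>2"] cong: if_cong)

context
  fixes A U :: "'k::scalar_field ^ 'n::finite ^ 'n" and \<sigma> :: "'n \<Rightarrow> real"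
  assumes dec: "singular_decomp A U \<sigma>"
begin

lemma dec_U: "unitary_mat U" and dec_nonneg: "0 \<le> \<sigma> i"
  and dec_eq: "adjoint_mat A ** A = U ** diag_mat (\<lambda>i. (\<sigma> i)\<^sup>2) ** adjoint_mat U"
  using dec by (auto simp: singular_decomp_def)

lemma dec_gram: "adjoint_mat (A ** U) ** (A ** U) = diag_mat (\<lambda>i. (\<sigma> i)\<^sup>2)"
proof -
  have "adjoint_mat (A ** U) ** (A ** U) = adjoint_mat U ** (adjoint_mat A ** A) ** U"
    by (simp add: adjoint_mult matrix_mul_assoc)
  also have "\<dots> = (adjoint_mat U ** U) ** diag_mat (\<lambda>i. (\<sigma> i)\<^sup>2) ** (adjoint_mat U ** U)"
    unfolding dec_eq by (simp only: matrix_mul_assoc)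
  finally show ?thesis
    using dec_U by (simp add: unitary_mat_def)
qed

lemma dec_vector: "A *v x = (A ** U) *v (adjoint_mat U *v x)"
  using dec_U by (simp add: matrix_vector_mul_assoc matrix_mul_assoc[symmetric] unitary_mat_def)

lemma norm_mult_le_Max: "norm (A *v x) \<le> Max (range \<sigma>) * norm x"
proof (rule power2_le_imp_le)
  let ?y = "adjoint_mat U *v x"
  have "(norm (A *v x))\<^sup>2 = (\<Sum>i\<in>UNIV. (\<sigma> i)\<^sup>2 * (norm (?y $ i))\<^sup>2)"
    unfolding dec_vector by (rule norm_sq_of_gram[OF dec_gram])
  also have "\<dots> \<le> (\<Sum>i\<in>UNIV. (Max (range \<sigma>))\<^sup>2 * (norm (?y $ i))\<^sup>2)"
    by (intro sum_mono mult_right_mono power_mono dec_nonneg) auto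
  also have "\<dots> = (Max (range \<sigma>))\<^sup>2 * (norm ?y)\<^sup>2"
    by (simp add: norm_vec_def L2_set_def sum_nonneg sum_distrib_left)
  also have "\<dots> = (Max (range \<sigma>) * norm x)\<^sup>2"
    by (simp add: norm_unitary_mult[OF unitary_adjoint[OF dec_U]] power_mult_distrib)
  finally show "(norm (A *v x))\<^sup>2 \<le> (Max (range \<sigma>) * norm x)\<^sup>2" .
  have "0 \<le> Max (range \<sigma>)"
    by (rule order.trans[OF dec_nonneg[of undefined] Max_ge]) auto
  then show "0 \<le> Max (range \<sigma>) * norm x"
    by simp
qed

lemma norm_column_dec: "norm (column i (A ** U)) = \<sigma> i"
proof -
  have "of_real ((norm (column i (A ** U)))\<^sup>2) = (adjoint_mat (A ** U) ** (A ** U)) $ i $ i"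
    by (simp only: adjoint_mult_nth cdot_self)
  also have "\<dots> = of_real ((\<sigma> i)\<^sup>2)"
    by (simp add: dec_gram diag_mat_def)
  finally have "(norm (column i (A ** U)))\<^sup>2 = (\<sigma> i)\<^sup>2"
    by (simp only: of_real_eq_iff)
  then show ?thesis
    using dec_nonneg[of i] by simp
qed

text \<open>Each \<sigma> \<open>i\<close> is attained at the unit vector \<open>column i U\<close>,
  which complements the upper bound.\<close>

lemma onorm_eq_Max: "onorm (\<lambda>x. A *v x) = Max (range \<sigma>)"
proof (rule antisym)
  show le: "onorm (\<lambda>x. A *v x) \<le> Max (range \<sigma>)"
    by (rule onorm_le[OF norm_mult_le_Max])
  have bl: "bounded_linear (\<lambda>x. A *v x)"
  proof (rule bounded_linear_intro)
    show "A *v (x + y) = A *v x + A *v y" for x y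
      by (rule matrix_vector_right_distrib)
    show "A *v (t *\<^sub>R x) = t *\<^sub>R (A *v x)" for t x
      by (simp add: vec_eq_iff matrix_vector_mult_def scaleR_sum_right)
    show "norm (A *v x) \<le> norm x * Max (range \<sigma>)" for x
      using norm_mult_le_Max[of x] by (simp add: mult.commute)
  qed
  have "\<sigma> i \<le> onorm (\<lambda>x. A *v x)" for i
  proof -
    have "norm (column i U) = 1"
      using norm_unitary_mult[OF dec_U, of "axis i 1"] by (simp add: matrix_mult_axis norm_axis_one)
    then show ?thesis
      using onorm[OF bl, of "column i U"] by (simp add: norm_column_dec flip: column_mult)
  qed
  then show "Max (range \<sigma>) \<le> onorm (\<lambda>x. A *v x)"
    by auto
qed

lemma trace_dec: "trace (U ** diag_mat d ** adjoint_mat U) = of_real (\<Sum>i\<in>UNIV. d i)"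
proof -
  have "trace (U ** diag_mat d ** adjoint_mat U) = trace (adjoint_mat U ** (U ** diag_mat d))"
    by (rule trace_mul_sym)
  also have "\<dots> = trace (diag_mat d :: 'k ^ 'n ^ 'n)"
    using dec_U by (simp add: matrix_mul_assoc unitary_mat_def)
  finally show ?thesis
    by (simp add: trace_def diag_mat_def)
qed

lemma schatten_norm_eq:
  assumes "1 \<le> p"
  shows "schatten_norm p A = lnorm p \<sigma>"
proof (cases p)
  case (real q)
  have "abs_mat A = U ** diag_mat \<sigma> ** adjoint_mat U"
    unfolding abs_mat_def
    by (subst psd_powr_eq[OF dec_U _ dec_eq]) (simp_all add: powr_half_sqrt dec_nonneg)
  then have "psd_powr (abs_mat A) q = U ** diag_mat (\<lambda>i. \<sigma> i powr q) ** adjoint_mat U"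
    by (rule psd_powr_eq[OF dec_U dec_nonneg])
  then have "trace (psd_powr (abs_mat A) q) = of_real (\<Sum>i\<in>UNIV. \<sigma> i powr q)"
    by (simp only: trace_dec)
  then have "norm (trace (psd_powr (abs_mat A) q)) = (\<Sum>i\<in>UNIV. \<sigma> i powr q)"
    by (simp only: norm_of_real) (simp add: sum_nonneg)
  then show ?thesis
    by (simp add: real schatten_norm_def lnorm_real)
next
  case PInf
  then show ?thesis
    by (simp add: schatten_norm_def lnorm_infinity onorm_eq_Max)
qed (use assms in simp)

text \<open>Both sides are the trace of \<open>adjoint_mat A ** A\<close>; this identifies the
  Euclidean norm of the entries with the Schatten 2-norm.\<close>

lemma sum_norm_entries: "(\<Sum>i\<in>UNIV. \<Sum>j\<in>UNIV. (norm (A $ i $ j))\<^sup>2) = (\<Sum>i\<in>UNIV. (\<sigma> i)\<^sup>2)"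
proof -
  have "of_real (\<Sum>j\<in>UNIV. (norm (column j A))\<^sup>2) = trace (adjoint_mat A ** A)"
    by (simp add: trace_def adjoint_mult_nth cdot_self del: of_real_power)
  also have "\<dots> = of_real (\<Sum>i\<in>UNIV. (\<sigma> i)\<^sup>2)"
    unfolding dec_eq by (rule trace_dec)
  finally have "(\<Sum>j\<in>UNIV. (norm (column j A))\<^sup>2) = (\<Sum>i\<in>UNIV. (\<sigma> i)\<^sup>2)"
    by (simp only: of_real_eq_iff)
  then show ?thesis
    by (subst sum.swap) (simp add: norm_vec_def L2_set_def column_def sum_nonneg)
qed

lemma norm_entry_le: "norm (A $ i $ j) \<le> Max (range \<sigma>)"
proof -
  have "norm (A $ i $ j) = norm ((A *v axis j 1) $ i)"
    by (simp add: matrix_mult_axis column_def)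
  also have "\<dots> \<le> norm (A *v axis j 1)"
    by (rule Finite_Cartesian_Product.norm_nth_le)
  also have "\<dots> \<le> Max (range \<sigma>)"
    using norm_mult_le_Max[of "axis j 1"] by (simp add: norm_axis_one)
  finally show ?thesis .
qed

text \<open>Duality of trace norm and operator norm. In the orthonormal basis of columns u_i of
  \<open>U\<close> the trace is a sum of inner products of W A u_i with u_i, and W A u_i has norm
  \<sigma>_i because \<open>W\<close> is isometric.\<close>

lemma norm_trace_unitary_le:
  assumes W: "unitary_mat W"
  shows "norm (trace (A ** W)) \<le> (\<Sum>i\<in>UNIV. \<sigma> i)"
proof -
  have "A ** W = (A ** U) ** (adjoint_mat U ** W)"
    using dec_U by (simp add: matrix_mul_assoc[symmetric] unitary_mat_def)
      (simp add: matrix_mul_assoc unitary_mat_def)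
  then have "trace (A ** W) = trace ((adjoint_mat U ** W) ** (A ** U))"
    by (simp only: trace_mul_sym[of "adjoint_mat U ** W"])
  also have "\<dots> = trace (adjoint_mat U ** (W ** (A ** U)))"
    by (simp only: matrix_mul_assoc)
  also have "\<dots> = (\<Sum>i\<in>UNIV. cdot (W *v column i (A ** U)) (column i U))"
    by (simp only: trace_def adjoint_mult_nth column_mult)
  also have "norm \<dots> \<le> (\<Sum>i\<in>UNIV. \<sigma> i)"
  proof (intro sum_norm_le)
    fix i
    have "norm (column i U) = 1"
      using norm_unitary_mult[OF dec_U, of "axis i 1"] by (simp add: matrix_mult_axis norm_axis_one)
    then show "norm (cdot (W *v column i (A ** U)) (column i U)) \<le> \<sigma> i"
      using norm_cdot_le[of "W *v column i (A ** U)" "column i U"]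
      by (simp add: norm_unitary_mult[OF W] norm_column_dec)
  qed
  finally show ?thesis .
qed

end

section \<open>Schatten classes\<close>

lemma singular_decomp_scale:
  assumes "singular_decomp A U \<sigma>"
  shows "singular_decomp (mat_scale t A) U (\<lambda>i. norm t * \<sigma> i)"
proof -
  have "(adjoint_mat (mat_scale t A) ** mat_scale t A) $ i $ j
      = of_real ((norm t)\<^sup>2) * (adjoint_mat A ** A) $ i $ j" for i j
    unfolding mult_conjugate_eq_norm[symmetric]
    by (simp add: matrix_matrix_mult_def adjoint_nth mat_scale_def map_matrix_def conjugate_dist_mul
        sum_distrib_left mult_ac)
  moreover have "(U ** diag_mat (\<lambda>i. (norm t * \<sigma> i)\<^sup>2) ** adjoint_mat U) $ i $ j
      = of_real ((norm t)\<^sup>2) * (U ** diag_mat (\<lambda>i. (\<sigma> i)\<^sup>2) ** adjoint_mat U) $ i $ j" for i j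
    unfolding matrix_matrix_mult_def[of "_ ** _"]
    by (simp add: mult_diag_nth power_mult_distrib sum_distrib_left mult_ac)
  ultimately show ?thesis
    using assms by (simp add: singular_decomp_def vec_eq_iff)
qed

lemma singular_decomp_unitary:
  assumes "unitary_mat A"
  shows "singular_decomp A (mat 1) (\<lambda>_. 1)"
  using assms unitary_mat_one[where 'k = 'a and 'n = 'b]
  by (simp add: singular_decomp_def unitary_mat_def diag_one)

lemma singular_decomp_matrix_unit:
  fixes i j :: "'n::finite"
  shows "singular_decomp (\<chi> k l. if k = i \<and> l = j then 1 else (0 :: 'k::scalar_field)) (mat 1) (\<lambda>l. if l = j then 1 else 0)"
proof -
  let ?E = "(\<chi> k l. if k = i \<and> l = j then 1 else 0) :: 'k ^ 'n ^ 'n"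
  have c1: "conjugate (1 :: 'k) = 1"
    using conjugate_of_real[of 1, where 'k = 'k] by simp
  have "(adjoint_mat ?E ** ?E) $ l $ m = (diag_mat (\<lambda>l. (if l = j then 1 else 0)\<^sup>2) :: 'k ^ 'n ^ 'n) $ l $ m" for l m
    by (auto simp: matrix_matrix_mult_def adjoint_nth diag_mat_def c1 if_distrib[of conjugate]
        if_distrib[of "\<lambda>x. x * _"] cong: if_cong)
  then have "adjoint_mat ?E ** ?E = diag_mat (\<lambda>l. (if l = j then 1 else 0)\<^sup>2)"
    by (simp only: vec_eq_iff) simp
  moreover have "adjoint_mat (mat 1) = (mat 1 :: 'k ^ 'n ^ 'n)"
    by (simp flip: diag_one)
  ultimately show ?thesis
    by (simp add: singular_decomp_def unitary_mat_one)
qed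

text \<open>The choice is harmless: facts such as \<open>schatten_norm_eq\<close> hold for every
  decomposition.\<close>

definition singular_values :: "'k::scalar_field ^ 'n::finite ^ 'n \<Rightarrow> 'n \<Rightarrow> real" where
  "singular_values A = (SOME \<sigma>. \<exists>U. singular_decomp A U \<sigma>)"

lemma singular_values:
  obtains U where "singular_decomp A U (singular_values A)"
proof -
  obtain U d where "singular_decomp A U d"
    by (rule exists_unitary_diagonalisation[of A]) (auto simp: singular_decomp_def)
  then have "\<exists>\<sigma> U. singular_decomp A U \<sigma>"
    by blast
  then have "\<exists>U. singular_decomp A U (singular_values A)"
    unfolding singular_values_def by (rule someI_ex)
  then show thesis
    using that by blast
qed

text \<open>Exchanging \<open>i\<close> with \<open>k\<close> in the arguments and \<open>j\<close>
  with \<open>l\<close> in the values is an involution that maps each set onto the other.\<close>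

lemma card_bij_point:
  "card {\<pi> :: 'n::finite \<Rightarrow> 'n. bij \<pi> \<and> \<pi> i = j} = card {\<pi> :: 'n \<Rightarrow> 'n. bij \<pi> \<and> \<pi> k = l}"
proof (rule bij_betw_same_card)
  let ?f = "\<lambda>\<pi>. Transposition.transpose j l \<circ> \<pi> \<circ> Transposition.transpose i k"
  show "bij_betw ?f {\<pi>. bij \<pi> \<and> \<pi> i = j} {\<pi>. bij \<pi> \<and> \<pi> k = l}"
    by (rule bij_betw_byWitness[where f' = ?f]) (auto simp: fun_eq_iff intro!: bij_comp)
qed

section \<open>Signed permutation matrices as a tight frame\<close>

definition signed_perms :: "(('n::finite \<Rightarrow> real) \<times> ('n \<Rightarrow> 'n)) set" where
  "signed_perms = signs \<times> {\<pi>. bij \<pi>}"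

definition signed_perm :: "('n \<Rightarrow> real) \<times> ('n \<Rightarrow> 'n) \<Rightarrow> 'n \<times> 'n \<Rightarrow> real" where
  "signed_perm a q = (if snd a (fst q) = snd q then fst a (fst q) else 0)"

text \<open>Summing over the signs removes pairs of entries from different rows; two different
  entries of one row are never both nonzero, as a permutation takes one value there. The number of
  permutations through a given entry does not depend on the entry, so \<open>undefined\<close>
  serves as reference point.\<close>

lemma signed_perm_frame:
  fixes q q' :: "'n::finite \<times> 'n"
  shows "(\<Sum>a\<in>signed_perms. signed_perm a q * signed_perm a q') =
    (if q = q' then card (signs :: ('n \<Rightarrow> real) set) *
      card {\<pi> :: 'n \<Rightarrow> 'n. bij \<pi> \<and> \<pi> undefined = undefined} else 0)"
proof -
  obtain i j k l where q: "q = (i, j)" "q' = (k, l)"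
    by (metis surj_pair)
  have "(\<Sum>a\<in>signed_perms. signed_perm a q * signed_perm a q') =
      (\<Sum>\<sigma>\<in>signs. \<Sum>\<pi> | bij \<pi>. \<sigma> i * \<sigma> k * (if \<pi> i = j \<and> \<pi> k = l then 1 else 0))"
    unfolding signed_perms_def sum.cartesian_product
    by (intro sum.cong refl) (auto simp: q signed_perm_def)
  also have "\<dots> = (\<Sum>\<sigma>\<in>signs. \<sigma> i * \<sigma> k) * (\<Sum>\<pi> | bij \<pi>. if \<pi> i = j \<and> \<pi> k = l then 1 else 0)"
    by (simp add: sum_product)
  also have "(\<Sum>\<pi> | bij \<pi>. if \<pi> i = j \<and> \<pi> k = l then 1 else 0) =
      real (card {\<pi>. bij \<pi> \<and> \<pi> i = j \<and> \<pi> k = l})"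
    by (simp flip: sum.inter_filter)
  also have "(\<Sum>\<sigma>\<in>signs. \<sigma> i * \<sigma> k) * real (card {\<pi>. bij \<pi> \<and> \<pi> i = j \<and> \<pi> k = l}) =
      (if q = q' then card (signs :: ('n \<Rightarrow> real) set) * card {\<pi> :: 'n \<Rightarrow> 'n. bij \<pi> \<and> \<pi> i = j} else 0)"
  proof (cases "i = k \<and> j \<noteq> l")
    case True
    then have "{\<pi>. bij \<pi> \<and> \<pi> i = j \<and> \<pi> k = l} = {}"
      by auto
    then show ?thesis
      using True by (simp only: card.empty) (simp add: q)
  qed (auto simp: sum_signs q)
  finally show ?thesis
    unfolding card_bij_point[of i j undefined undefined] .
qed

lemma unitary_signed_perm:
  assumes "a \<in> signed_perms"
  shows "unitary_mat (\<chi> i j. of_real (signed_perm a (i, j)) :: 'k::scalar_field ^ 'n::finite ^ 'n)"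
proof -
  obtain \<sigma> \<pi> where a: "a = (\<sigma>, \<pi>)" and \<sigma>: "\<sigma> \<in> signs" and \<pi>: "bij \<pi>"
    using assms by (auto simp: signed_perms_def)
  let ?H = "(\<chi> i j. of_real (signed_perm a (i, j))) :: 'k ^ 'n ^ 'n"
  have "(?H ** adjoint_mat ?H) $ i $ k = mat 1 $ i $ k" for i k
  proof -
    have "(?H ** adjoint_mat ?H) $ i $ k =
        (\<Sum>j\<in>UNIV. of_real (signed_perm a (i, j) * signed_perm a (k, j)))"
      by (simp add: matrix_matrix_mult_def adjoint_nth)
    also have "\<dots> = (\<Sum>j\<in>UNIV. if j = \<pi> i then (if i = k then 1 else 0) else 0)"
      using bij_is_inj[OF \<pi>, THEN injD, of i k]
      by (intro sum.cong refl) (auto simp: a signed_perm_def square_signs[OF \<sigma>] simp flip: of_real_mult)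
    finally show ?thesis
      by (simp add: mat_def)
  qed
  then have "?H ** adjoint_mat ?H = mat 1"
    by (simp only: vec_eq_iff) simp
  then show ?thesis
    using matrix_left_right_inverse[of ?H "adjoint_mat ?H"] by (simp add: unitary_mat_def)
qed

lemma sum_signed_perm_square:
  fixes a :: "('n::finite \<Rightarrow> real) \<times> ('n \<Rightarrow> 'n)"
  assumes "a \<in> signed_perms"
  shows "(\<Sum>q\<in>UNIV. (signed_perm a q)\<^sup>2) = CARD('n)"
proof -
  obtain \<sigma> \<pi> where a: "a = (\<sigma>, \<pi>)" and \<sigma>: "\<sigma> \<in> signs"
    using assms by (auto simp: signed_perms_def)
  have "(\<Sum>q\<in>UNIV. (signed_perm a q)\<^sup>2) = (\<Sum>i\<in>UNIV. \<Sum>j\<in>UNIV. (signed_perm a (i, j))\<^sup>2)"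
    by (simp add: sum.cartesian_product flip: UNIV_Times_UNIV)
  also have "\<dots> = (\<Sum>i\<in>(UNIV :: 'n set). \<Sum>j\<in>(UNIV :: 'n set). if \<pi> i = j then 1 else 0)"
    by (intro sum.cong refl) (simp add: a signed_perm_def power2_eq_square square_signs[OF \<sigma>])
  finally show ?thesis
    by simp
qed

text \<open>Indexing by pairs makes n^2 the dimension in the abstract theorem, while the families of
  singular values keep length n.\<close>

definition entries :: "'k::scalar_field ^ 'n ^ 'n \<Rightarrow> 'k ^ ('n::finite \<times> 'n)" where
  "entries A = (\<chi> q. A $ fst q $ snd q)"

lemma bij_entries: "bij (entries :: 'k::scalar_field ^ 'n::finite ^ 'n \<Rightarrow> _)"
proof (rule bij_betw_byWitness[where f' = "\<lambda>y. \<chi> i j. y $ (i, j)"])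
qed (auto simp: entries_def vec_eq_iff)

theorem schatten_tensor_radius:
  assumes "1 \<le> p"
  shows "has_tensor_radius mat_scale (schatten_norm p :: 'k::scalar_field ^ 'n::finite ^ 'n \<Rightarrow> real)
    (CARD('n) powr (2 - \<bar>1 / 2 - real_of_ereal (1 / p)\<bar>))"
proof -
  interpret coordinates "mat_scale :: 'k \<Rightarrow> 'k ^ 'n ^ 'n \<Rightarrow> 'k ^ 'n ^ 'n" entries
    by unfold_locales
      (simp_all add: bij_entries entries_def mat_scale_def map_matrix_def vec_eq_iff algebra_simps)
  have ve: "ve y = (\<chi> i j. y $ (i, j))" for y
    unfolding co_inject[symmetric] co_ve by (simp add: entries_def vec_eq_iff)
  have sv_nonneg: "0 \<le> singular_values A i" for A :: "'k ^ 'n ^ 'n" and i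
    by (rule singular_values[of A]) (simp add: singular_decomp_def)
  have schatten: "schatten_norm p A = lnorm p (singular_values A)" for A :: "'k ^ 'n ^ 'n"
    by (rule singular_values[of A]) (rule schatten_norm_eq[OF _ assms])
  interpret lnorm_space "mat_scale :: 'k \<Rightarrow> 'k ^ 'n ^ 'n \<Rightarrow> 'k ^ 'n ^ 'n" entries p "schatten_norm p"
    singular_values signed_perms signed_perm
    "card (signs :: ('n \<Rightarrow> real) set) * card {\<pi> :: 'n \<Rightarrow> 'n. bij \<pi> \<and> \<pi> undefined = undefined}"
  proof
    show "schatten_norm p (mat_scale t A) = norm t * schatten_norm p A" for t and A :: "'k ^ 'n ^ 'n"
    proof (rule singular_values[of A])
      fix U assume U: "singular_decomp A U (singular_values A)"
      show ?thesis
        unfolding schatten_norm_eq[OF U assms] schatten_norm_eq[OF singular_decomp_scale[OF U] assms]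
        by (rule lnorm_scale) (simp_all add: sv_nonneg assms)
    qed
    show "norm (entries A) = lnorm 2 (singular_values A)" for A :: "'k ^ 'n ^ 'n"
    proof (rule singular_values[of A])
      fix U assume U: "singular_decomp A U (singular_values A)"
      have "(\<Sum>q\<in>UNIV. (norm (A $ fst q $ snd q))\<^sup>2) = (\<Sum>i\<in>UNIV. \<Sum>j\<in>UNIV. (norm (A $ i $ j))\<^sup>2)"
        by (simp add: sum.cartesian_product case_prod_beta flip: UNIV_Times_UNIV)
      then show ?thesis
        unfolding lnorm_2[OF sv_nonneg] sum_norm_entries[OF U, symmetric]
        by (simp add: norm_vec_def L2_set_def entries_def)
    qed
    show "(\<Sum>a\<in>signed_perms. signed_perm a q * signed_perm a q') =
      (if q = q' then real (card (signs :: ('n \<Rightarrow> real) set) *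
      card {\<pi> :: 'n \<Rightarrow> 'n. bij \<pi> \<and> \<pi> undefined = undefined}) else 0)" for q q' :: "'n \<times> 'n"
      by (simp add: signed_perm_frame)
    show "schatten_norm p (ve (\<chi> q. of_real (signed_perm a q))) \<le> CARD('n) powr real_of_ereal (1 / p)"
      if "a \<in> signed_perms" for a
      using schatten_norm_eq[OF singular_decomp_unitary[OF unitary_signed_perm[OF that, where 'k = 'k]] assms]
        lnorm_one[OF assms, where 'n = 'n] by (simp add: ve)
    show "norm (fun_of (\<chi> q. of_real (signed_perm a q)) A) \<le> lnorm 1 (singular_values A)"
      if a: "a \<in> signed_perms" for a and A :: "'k ^ 'n ^ 'n"
    proof (rule singular_values[of A])
      fix U assume U: "singular_decomp A U (singular_values A)"
      let ?H = "(\<chi> i j. of_real (signed_perm a (i, j))) :: 'k ^ 'n ^ 'n"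
      have "fun_of (\<chi> q. of_real (signed_perm a q)) A =
          (\<Sum>i\<in>UNIV. \<Sum>j\<in>UNIV. A $ i $ j * of_real (signed_perm a (i, j)))"
        by (simp add: fun_of_def entries_def sum.cartesian_product case_prod_beta flip: UNIV_Times_UNIV)
      \<comment> \<open>The matrix \<open>?H\<close> is real, so its adjoint is its transpose and
        the bilinear pairing of entries becomes a trace.\<close>
      also have "\<dots> = trace (A ** adjoint_mat ?H)"
        by (simp add: trace_def matrix_matrix_mult_def adjoint_nth)
      finally show ?thesis
        unfolding lnorm_1[OF sv_nonneg]
        using norm_trace_unitary_le[OF U unitary_adjoint[OF unitary_signed_perm[OF a]]] by simp
    qed
    show "schatten_norm p (ve (axis q 1)) \<le> 1" for q
    proof -
      have "ve (axis q 1) = (\<chi> k l. if k = fst q \<and> l = snd q then 1 else 0)"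
        by (auto simp: ve vec_eq_iff axis_def)
      then show ?thesis
        using schatten_norm_eq[OF singular_decomp_matrix_unit[of "fst q" "snd q"] assms, where 'k = 'k]
        by (simp add: lnorm_single[OF assms])
    qed
    show "norm (entries A $ q) \<le> lnorm \<infinity> (singular_values A)" for A :: "'k ^ 'n ^ 'n" and q
      by (rule singular_values[of A]) (simp add: entries_def lnorm_infinity norm_entry_le)
    show "(\<Sum>q\<in>UNIV. (signed_perm a q)\<^sup>2) = CARD('n)" if "a \<in> signed_perms" for a :: "('n \<Rightarrow> real) \<times> ('n \<Rightarrow> 'n)"
      by (rule sum_signed_perm_square[OF that])
    show "finite (signed_perms :: (('n \<Rightarrow> real) \<times> ('n \<Rightarrow> 'n)) set)"
      by (simp add: signed_perms_def finite_signs)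
    show "(signed_perms :: (('n \<Rightarrow> real) \<times> ('n \<Rightarrow> 'n)) set) \<noteq> {}"
      using signs_nonempty bij_id by (auto simp: signed_perms_def)
  qed (simp_all add: assms schatten sv_nonneg)
  show ?thesis
    using tensor_radius by (simp add: powr_diff power2_eq_square)
qed

theorem corollary4p5:
  fixes p :: ereal and n :: nat
  assumes "1 \<le> p" and "n = CARD('n::finite)"
  shows
    "(has_tensor_radius vec_scale (lp_norm p :: real ^ 'n \<Rightarrow> real)
        (real n powr (1 - \<bar>1 / 2 - real_of_ereal (1 / p)\<bar>)) \<and>
      has_tensor_radius vec_scale (lp_norm p :: complex ^ 'n \<Rightarrow> real)
        (real n powr (1 - \<bar>1 / 2 - real_of_ereal (1 / p)\<bar>))) \<and>
     (has_tensor_radius mat_scale (schatten_norm p :: real ^ 'n ^ 'n \<Rightarrow> real)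
        (real n powr (2 - \<bar>1 / 2 - real_of_ereal (1 / p)\<bar>)) \<and>
      has_tensor_radius mat_scale (schatten_norm p :: complex ^ 'n ^ 'n \<Rightarrow> real)
        (real n powr (2 - \<bar>1 / 2 - real_of_ereal (1 / p)\<bar>)))"
  unfolding assms(2)
  by (intro conjI lp_tensor_radius schatten_tensor_radius assms(1))

end
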